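(* Let $N\in\mathbb{N}$ be square-free. Let $l,m>1$ be integers, let $a,b\in\mathbb{N}$ be such that $\operatorname{lcm}(a,b)\mid N$, and put $k=l+m$. Then there exists a cusp form $C_N(z)=C_N(E_{2l}(az)E_{2m}(bz);z)\in S_{2k}(\Gamma_0(N))$ such that $$E_{2l}(az)E_{2m}(bz)=\sum_{d\mid N}\left(\sum_{c\mid N}\frac{(-1)^{\omega(d)+\omega(c)}}{\prod_{p\mid N}(p^{2k}-1)}\left(\frac{N\gcd(c,d)}{c}\right)^{2k}\left(\frac{\gcd(a,c)}{a}\right)^{2l}\left(\frac{\gcd(b,c)}{b}\right)^{2m}\right)E_{2k}(dz)+C_N(z).$$ Consequently, for every integer $n>0$, $$\begin{aligned}W(a^{2l-1},b^{2m-1};n)={}&\frac{-kB_{2l}B_{2m}}{4lmB_{2k}}\sum_{d\mid N}\left(\sum_{c\mid N}\frac{(-1)^{\omega(d)+\omega(c)}}{\prod_{p\mid N}(p^{2k}-1)}\left(\frac{N\gcd(c,d)}{c}\right)^{2k}\left(\frac{\gcd(a,c)}{a}\right)^{2l}\left(\frac{\gcd(b,c)}{b}\right)^{2m}\right)\sigma_{2k-1}(n/d)\\&+\frac{B_{2l}}{4l}\sigma_{2m-1}(n/b)+\frac{B_{2m}}{4m}\sigma_{2l-1}(n/a)+\frac{B_{2l}B_{2m}}{16lm}[n]C_N(z).\end{aligned}$$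
   Context: Throughout, $z$ lies in the upper half plane, $q=e^{2\pi i z}$, $p$ denotes primes, and all divisors are positive. $S_{w}(\Gamma_0(N))$ is the space of cusp forms of weight $w$ for $\Gamma_0(N)$. $\omega(d)$ is the number of distinct prime divisors of $d$. $\sigma_j(n)=\sum_{1\le d\mid n}d^j$ for $n\in\mathbb{N}$, with $\sigma_j(n)=0$ if $n\notin\mathbb{N}$. The Bernoulli numbers are defined by $\frac{x}{e^x-1}=\sum_{n\ge0}B_nx^n/n!$, and $E_{2k}(z)=1-\frac{4k}{B_{2k}}\sum_{n\ge1}\sigma_{2k-1}(n)q^n$. $[n]f(z)$ denotes the coefficient of $q^n$ in the Fourier expansion of $f$ at $\infty$. For $a,b,u,v\in\mathbb{N}$ and $n>0$, the convolution sum is $$W(a^{u},b^{v};n)=\sum_{\substack{r,s\in\mathbb{N}\\ ar+bs=n}}\sigma_u(r)\sigma_v(s)$$ (the exponents in $W(a^u,b^v;n)$ are purely notational). *)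

theory Defs
  imports "HOL-Complex_Analysis.Complex_Analysis" "HOL-Computational_Algebra.Squarefree"
begin

text \<open>
  The arguments of \<open>\<sigma>\<^sub>j\<close> are quotients such as \<open>n/d\<close>, so it is a function on the rationals that
  vanishes outside the positive integers.
\<close>
definition divisor_sigma :: "nat \<Rightarrow> rat \<Rightarrow> nat" where
  "divisor_sigma j x =
     (if x \<in> \<nat> \<and> x > 0 then \<Sum>d | d dvd nat \<lfloor>x\<rfloor>. d ^ j else 0)"

definition omega :: "nat \<Rightarrow> nat" where
  "omega d = card (prime_factors d)"

text \<open>
  The quotient is taken in the ring of formal power series over the reals, where the common
  factor \<open>X\<close> cancels.
\<close>
definition bernoulli :: "nat \<Rightarrow> real" where
  "bernoulli n = fact n * fps_nth (fps_X / (fps_exp 1 - 1)) n"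

abbreviation upper_half_plane :: "complex set" where
  "upper_half_plane \<equiv> {z. Im z > 0}"

text \<open>
  \<open>w\<close> is the weight, so for \<open>w = 2k\<close> the factor in front of the series is \<open>4k / B\<^bsub>2k\<^esub>\<close>. The series
  is indexed from \<open>0\<close>; its \<open>n\<close>-th term belongs to \<open>q\<^bsup>n+1\<^esup>\<close>.
\<close>
definition eisenstein :: "nat \<Rightarrow> complex \<Rightarrow> complex" where
  "eisenstein w z = 1 - of_real (2 * of_nat w / bernoulli w) *
     (\<Sum>n. of_nat (divisor_sigma (w - 1) (of_nat (Suc n))) *
           exp (2 * of_real pi * \<i> * z) ^ Suc n)"

definition Gamma0 :: "nat \<Rightarrow> (int ^ 2 ^ 2) set" where
  "Gamma0 N = {A. det A = 1 \<and> int N dvd A $ 2 $ 1}"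

text \<open>
  \<open>slash w A f\<close> is \<open>f[A]\<^sub>w\<close>, i.e. \<open>(c z + d)\<^bsup>-w\<^esup> f ((a z + b) / (c z + d))\<close> where \<open>A\<close> has the
  rows \<open>(a, b)\<close> and \<open>(c, d)\<close>.
\<close>
definition slash :: "nat \<Rightarrow> int ^ 2 ^ 2 \<Rightarrow> (complex \<Rightarrow> complex) \<Rightarrow> complex \<Rightarrow> complex" where
  "slash w A f z =
     f ((of_int (A $ 1 $ 1) * z + of_int (A $ 1 $ 2)) /
        (of_int (A $ 2 $ 1) * z + of_int (A $ 2 $ 2))) /
     (of_int (A $ 2 $ 1) * z + of_int (A $ 2 $ 2)) ^ w"

text \<open>
  Fourier expansion in \<open>q\<^sub>h = exp (2 \<pi> \<i> z / h)\<close> with no negative powers.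
\<close>
definition has_fourier_expansion :: "nat \<Rightarrow> (complex \<Rightarrow> complex) \<Rightarrow> (nat \<Rightarrow> complex) \<Rightarrow> bool" where
  "has_fourier_expansion h f c \<longleftrightarrow>
     (\<forall>z\<in>upper_half_plane.
        (\<lambda>n. c n * exp (2 * of_real pi * \<i> * z / of_nat h) ^ n) sums f z)"

text \<open>
  \<open>S\<^sub>w(\<Gamma>\<^sub>0(N))\<close>. Modular forms are total functions of which only the restriction to the upper half
  plane matters. The condition at the cusps is imposed on \<open>f[A]\<^sub>w\<close> for all \<open>A\<close> in
  \<open>SL\<^sub>2(\<int>) = \<Gamma>\<^sub>0(1)\<close>; each \<open>f[A]\<^sub>w\<close> is invariant under \<open>z \<mapsto> z + N\<close> because \<open>\<Gamma>\<^sub>0(N)\<close> contains the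
  normal subgroup \<open>\<Gamma>(N)\<close> of \<open>SL\<^sub>2(\<int>)\<close>, so it is expanded in \<open>q\<^sub>N\<close> irrespective of the exact width
  of the cusp.
\<close>
definition cusp_forms :: "nat \<Rightarrow> nat \<Rightarrow> (complex \<Rightarrow> complex) set" where
  "cusp_forms w N = {f.
     f holomorphic_on upper_half_plane \<and>
     (\<forall>A\<in>Gamma0 N. \<forall>z\<in>upper_half_plane. slash w A f z = f z) \<and>
     (\<forall>A\<in>Gamma0 1. \<exists>c. has_fourier_expansion N (slash w A f) c \<and> c 0 = 0)}"

text \<open>
  \<open>[n]f\<close>, for \<open>f\<close> with an expansion in \<open>q = q\<^sub>1\<close> (such an expansion is unique).
\<close>
definition fourier_coeff :: "nat \<Rightarrow> (complex \<Rightarrow> complex) \<Rightarrow> complex" where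
  "fourier_coeff n f = (THE c. has_fourier_expansion 1 f c) n"

text \<open>\<open>convolution_sum a u b v n\<close> is \<open>W(a\<^sup>u, b\<^sup>v; n)\<close>.\<close>
definition convolution_sum :: "nat \<Rightarrow> nat \<Rightarrow> nat \<Rightarrow> nat \<Rightarrow> nat \<Rightarrow> nat" where
  "convolution_sum a u b v n =
     (\<Sum>(r, s) | r > 0 \<and> s > 0 \<and> a * r + b * s = n.
        divisor_sigma u (of_nat r) * divisor_sigma v (of_nat s))"

end

theory Submission
  imports Defs
begin

text \<open>
  Subtract from the product \<open>E\<^bsub>2l\<^esub>(a z) E\<^bsub>2m\<^esub>(b z)\<close> a combination \<open>\<Sum>\<^sub>d x\<^sub>d E\<^bsub>2k\<^esub>(d z)\<close> over the divisors \<open>d\<close> of \<open>N\<close>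
  that has the same constant term at every cusp. What remains is a cusp form.

  For the constant terms, let \<open>A\<close> be in the full modular group with lower left entry \<open>c\<close>, and let \<open>t\<close> divide \<open>N\<close>.
  Then \<open>E\<^sub>w(t z)\<close> transformed by \<open>A\<close> is \<open>\<delta>\<^bsup>-w\<^esup> E\<^sub>w((\<alpha> z + \<beta>) / \<delta>)\<close> with \<open>\<alpha> = gcd t c\<close> and \<open>\<alpha> \<delta> = t\<close>
  (\<open>eisenstein_dilate_slash_SL2\<close>). It has an expansion in the nome of width \<open>N\<close> with constant term
  \<open>(gcd t e / t)\<^sup>w\<close>, where \<open>e = gcd N c\<close>. The conditions on the \<open>x\<^sub>d\<close> are therefore
  \<open>\<Sum>\<^sub>d x\<^sub>d (gcd d e / d)\<^bsup>2k\<^esup> = (gcd a e / a)\<^bsup>2l\<^esup> (gcd b e / b)\<^bsup>2m\<^esup>\<close> for each divisor \<open>e\<close> of \<open>N\<close>. As \<open>N\<close> is square-free,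
  the matrix of this system is a tensor product of \<open>2 \<times> 2\<close> matrices, one for each prime factor of \<open>N\<close>, and its
  inverse is explicit (\<open>divisor_gcd_linear_system\<close>). This yields the stated coefficients.

  The analytic input is the modularity of \<open>E\<^sub>w\<close> for even \<open>w \<ge> 4\<close>, defined by its Fourier series. It is inherited
  from the lattice sum \<open>\<Sum> (m z + n)\<^bsup>-w\<^esup>\<close>, on which unimodular substitutions act by permuting the terms. The
  two series are proportional (\<open>eisenstein_eq_lattice_sum\<close>) by the Lipschitz summation formula and
  by Euler's evaluation of \<open>\<zeta>(w)\<close>. Both express the reflection formula of the digamma function: the first through
  its derivatives in the upper half plane, the second through its Taylor expansion at \<open>0\<close>.

  The formula for the convolution sum follows by comparing the coefficients of \<open>q\<^sup>n\<close>: the coefficient of the product is a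
  Cauchy product whose inner terms form the convolution sum and whose two outer terms are the single divisor sums.
\<close>

section \<open>Polygamma functions and the Lipschitz summation formula\<close>

text \<open>
  Logarithmic differentiation of the reflection formula for \<open>\<Gamma>\<close>. It replaces the partial fraction
  decomposition of the cotangent: the left-hand side is that decomposition in disguise, since
  \<open>Digamma\<close> is a series over the non-positive integers.
\<close>
lemma Digamma_reflection:
  fixes z :: complex
  assumes "z \<notin> \<int>"
  shows "Digamma (1 - z) - Digamma z = of_real pi * cot (of_real pi * z)"
proof -
  have z: "z \<notin> \<int>\<^sub>\<le>\<^sub>0" and z1: "1 - z \<notin> \<int>\<^sub>\<le>\<^sub>0"
    using assms nonpos_Ints_Int by (auto intro: Ints_diff[of 1 "1 - z", simplified])
  have nz: "sin (of_real pi * z) \<noteq> 0"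
  proof
    assume "sin (of_real pi * z) = 0"
    then obtain n :: int where "of_real pi * z = of_real (of_int n * pi)"
      by (auto simp: sin_eq_0 mult.commute)
    hence "z = of_int n" by simp
    with assms show False by simp
  qed
  have eq: "(\<lambda>z. rGamma z * rGamma (1 - z) :: complex) = (\<lambda>z. sin (of_real pi * z) / of_real pi)"
    by (simp add: rGamma_reflection_complex)
  have d1: "((\<lambda>z. rGamma z * rGamma (1 - z)) has_field_derivative
     (rGamma z * rGamma (1 - z)) * (Digamma (1 - z) - Digamma z)) (at z)"
    using z z1 by (auto intro!: derivative_eq_intros simp: algebra_simps)
  have d2: "((\<lambda>z. sin (of_real pi * z) / of_real pi) has_field_derivative cos (of_real pi * z)) (at z)"
    by (auto intro!: derivative_eq_intros)
  have "(rGamma z * rGamma (1 - z)) * (Digamma (1 - z) - Digamma z) = cos (of_real pi * z)"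
    using DERIV_unique[OF d1[unfolded eq] d2] .
  with nz show ?thesis by (simp add: rGamma_reflection_complex cot_def field_simps)
qed

lemma pi_cot_eq_nome:
  fixes z :: complex
  assumes "sin (of_real pi * z) \<noteq> 0"
  shows "of_real pi * cot (of_real pi * z) = \<i> * pi + 2 * \<i> * pi / (exp (2 * of_real pi * \<i> * z) - 1)"
proof -
  define e where "e = exp (\<i> * (of_real pi * z))"
  have e0: "e \<noteq> 0" by (simp add: e_def)
  have e2: "exp (2 * of_real pi * \<i> * z) = e ^ 2"
    unfolding e_def exp_of_nat_mult[symmetric] by (rule arg_cong[of _ _ exp]) (simp add: algebra_simps)
  have em: "exp (- (\<i> * (of_real pi * z))) = inverse e" by (simp add: e_def exp_minus)
  have s: "sin (of_real pi * z) = (e - inverse e) / (2 * \<i>)"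
    unfolding sin_exp_eq em by (simp add: e_def)
  have c: "cos (of_real pi * z) = (e + inverse e) / 2"
    unfolding cos_exp_eq em by (simp add: e_def)
  have "e - inverse e \<noteq> 0" using assms s by auto
  hence n1: "e\<^sup>2 - 1 \<noteq> 0" using e0 by (auto simp: field_simps power2_eq_square)
  have n2: "e * e \<noteq> 1" using n1 by (simp add: power2_eq_square)
  have "cot (of_real pi * z) = \<i> * (e\<^sup>2 + 1) / (e\<^sup>2 - 1)"
    unfolding cot_def s c using e0 n1 n2 by (simp add: field_simps power2_eq_square)
  also have "\<dots> = \<i> + 2 * \<i> / (e\<^sup>2 - 1)" using n1 by (simp add: field_simps)
  finally show ?thesis unfolding e2 by (simp add: algebra_simps)
qed

lemma one_plus_notin_nonpos_Ints:
  fixes w :: complex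
  assumes "norm w < 1"
  shows "1 + w \<notin> \<int>\<^sub>\<le>\<^sub>0"
proof
  assume "1 + w \<in> \<int>\<^sub>\<le>\<^sub>0"
  then obtain n :: int where n: "1 + w = of_int n" "n \<le> 0" by (elim nonpos_Ints_cases)
  have "Re (1 + w) \<le> 0" unfolding n(1) using n(2) by simp
  moreover have "\<bar>Re w\<bar> < 1" using abs_Re_le_cmod[of w] assms by linarith
  ultimately show False by simp
qed

lemma higher_deriv_Digamma_diff:
  fixes z :: complex
  assumes "norm z < 1"
  shows "(deriv ^^ n) (\<lambda>z. Digamma (1 - z) - Digamma (1 + z)) z =
           (-1) ^ n * Polygamma n (1 - z) - Polygamma n (1 + z)"
  using assms
proof (induction n arbitrary: z)
  case (Suc n)
  have n1: "1 + z \<notin> \<int>\<^sub>\<le>\<^sub>0" using one_plus_notin_nonpos_Ints[of z] Suc.prems by simp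
  have n2: "1 - z \<notin> \<int>\<^sub>\<le>\<^sub>0" using one_plus_notin_nonpos_Ints[of "-z"] Suc.prems by simp
  have "(deriv ^^ Suc n) (\<lambda>z. Digamma (1 - z) - Digamma (1 + z)) z =
        deriv (\<lambda>z. (-1) ^ n * Polygamma n (1 - z) - Polygamma n (1 + z)) z"
    using Suc by (auto intro!: deriv_cong_ev eventually_nhds_in_open[THEN eventually_mono, of "ball 0 1"])
  also have "\<dots> = (-1) ^ Suc n * Polygamma (Suc n) (1 - z) - Polygamma (Suc n) (1 + z)"
    using n1 n2 by (intro DERIV_imp_deriv) (auto intro!: derivative_eq_intros)
  finally show ?case .
qed auto

lemma zeta_sums_Polygamma_1:
  assumes "n > 0"
  shows "(\<lambda>k. 1 / of_nat (Suc k) ^ Suc n) sums ((-1) ^ Suc n * Polygamma n (1::complex) / fact n)"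
  using Polygamma_LIMSEQ[of "1::complex" n] assms by (simp add: field_simps)

lemma summable_power_times_geometric:
  fixes x :: complex
  assumes "norm x < 1"
  shows "summable (\<lambda>r. of_nat r ^ n * x ^ r)"
  using assms
proof (induction n arbitrary: x)
  case 0
  thus ?case by (simp add: summable_geometric)
next
  case (Suc n)
  have "summable (\<lambda>r. diffs (\<lambda>r. of_nat r ^ n) r * x ^ r)"
    by (rule termdiff_converges[where K = 1]) (use Suc in auto)
  hence "summable (\<lambda>r. x * (diffs (\<lambda>r. of_nat r ^ n) r * x ^ r))"
    by (rule summable_mult)
  hence "summable (\<lambda>r. of_nat (Suc r) ^ Suc n * x ^ Suc r)"
    by (simp add: diffs_def algebra_simps)
  thus ?case by (subst (asm) summable_Suc_iff)
qed

text \<open>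
  The operator \<open>x d/dx\<close>, which is \<open>d/dz\<close> up to the factor \<open>2 \<pi> \<i>\<close> when \<open>x = exp (2 \<pi> \<i> z)\<close>,
  raises the power of \<open>r\<close> by one.
\<close>
lemma DERIV_power_times_geometric:
  fixes x :: complex
  assumes "norm x < 1"
  obtains D where "((\<lambda>x. \<Sum>r. of_nat r ^ n * x ^ r) has_field_derivative D) (at x)"
    "x * D = (\<Sum>r. of_nat r ^ Suc n * x ^ r)"
proof
  let ?D = "\<Sum>r. diffs (\<lambda>r. of_nat r ^ n) r * x ^ r"
  show "((\<lambda>x. \<Sum>r. of_nat r ^ n * x ^ r) has_field_derivative ?D) (at x)"
    by (rule termdiffs_strong'[where K = 1]) (use assms summable_power_times_geometric in auto)
  have "summable (\<lambda>r. diffs (\<lambda>r. of_nat r ^ n) r * x ^ r)"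
    by (rule termdiff_converges[where K = 1]) (use assms summable_power_times_geometric in auto)
  hence "x * ?D = (\<Sum>r. x * (diffs (\<lambda>r. of_nat r ^ n) r * x ^ r))"
    by (rule suminf_mult[symmetric])
  also have "\<dots> = (\<Sum>r. of_nat (Suc r) ^ Suc n * x ^ Suc r)"
    by (simp add: diffs_def algebra_simps)
  also have "\<dots> = (\<Sum>r. of_nat r ^ Suc n * x ^ r)"
    using suminf_split_head[OF summable_power_times_geometric[OF assms, of "Suc n"]] by simp
  finally show "x * ?D = (\<Sum>r. of_nat r ^ Suc n * x ^ r)" .
qed

lemma norm_nome_less_1:
  assumes "Im z > 0" "c > 0"
  shows "norm (exp (2 * of_real pi * \<i> * z / of_real c)) < 1"
  using assms by (simp add: Re_divide_of_real zero_less_divide_iff)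

lemma norm_nome_width_1_less_1:
  assumes "Im z > 0"
  shows "norm (exp (2 * of_real pi * \<i> * z)) < 1"
  using norm_nome_less_1[of z 1] assms by simp

text \<open>
  For \<open>n = 0\<close> this is the cotangent written as a geometric series in the nome, and each further \<open>n\<close>
  comes from differentiating once more. The constant term \<open>\<i> \<pi>\<close> does not survive the first
  derivative.
\<close>
lemma Polygamma_reflection:
  fixes z :: complex
  assumes "Im z > 0" 
  shows "(-1) ^ n * Polygamma n (1 - z) - Polygamma n z =
           (if n = 0 then \<i> * of_real pi else 0) -
           (2 * of_real pi * \<i>) ^ Suc n * (\<Sum>r. of_nat r ^ n * exp (2 * of_real pi * \<i> * z) ^ r)"
  using assms
proof (induction n arbitrary: z)
  case 0
  have Z: "z \<notin> \<int>" using 0 by (auto elim!: Ints_cases)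
  hence "sin (of_real pi * z) \<noteq> 0"
    by (auto simp: sin_eq_0 mult.commute)
  moreover have "exp (2 * of_real pi * \<i> * z) \<noteq> 1"
    using norm_nome_width_1_less_1[OF 0] by (metis norm_one less_irrefl)
  ultimately show ?case
    using norm_nome_width_1_less_1[OF 0]
    by (simp add: Digamma_reflection[OF Z] pi_cot_eq_nome suminf_geometric divide_simps) 
       (simp add: algebra_simps)
next
  case (Suc n)
  let ?q = "\<lambda>z. exp (2 * of_real pi * \<i> * z)"
  have nonpos: "w \<notin> \<int>\<^sub>\<le>\<^sub>0" if "Im w \<noteq> 0" for w :: complex
    using that by (auto elim!: nonpos_Ints_cases)
  have n1: "z \<notin> \<int>\<^sub>\<le>\<^sub>0" and n2: "1 - z \<notin> \<int>\<^sub>\<le>\<^sub>0" using Suc.prems by (auto intro!: nonpos)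
  obtain D where D: "((\<lambda>x. \<Sum>r. of_nat r ^ n * x ^ r) has_field_derivative D) (at (?q z))"
    "?q z * D = (\<Sum>r. of_nat r ^ Suc n * ?q z ^ r)"
    using DERIV_power_times_geometric[OF norm_nome_width_1_less_1[OF Suc.prems]] by blast
  have d: "((\<lambda>z. \<Sum>r. of_nat r ^ n * ?q z ^ r) has_field_derivative D * (?q z * (2 * of_real pi * \<i>))) (at z)"
    by (rule DERIV_chain2[where g = ?q, OF D(1)]) (auto intro!: derivative_eq_intros)
  have d1: "((\<lambda>z. (if n = 0 then \<i> * of_real pi else 0) -
           (2 * of_real pi * \<i>) ^ Suc n * (\<Sum>r. of_nat r ^ n * ?q z ^ r)) has_field_derivative
       0 - (2 * of_real pi * \<i>) ^ Suc n * (D * (?q z * (2 * of_real pi * \<i>)))) (at z)"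
    by (intro DERIV_diff DERIV_const DERIV_cmult d)
  have d2: "((\<lambda>z. (-1) ^ n * Polygamma n (1 - z) - Polygamma n z) has_field_derivative
      ((-1) ^ Suc n * Polygamma (Suc n) (1 - z) - Polygamma (Suc n) z)) (at z)"
    using n1 n2 by (auto intro!: derivative_eq_intros)
  have ev: "eventually (\<lambda>w. Im w > 0) (nhds z)"
    using Suc.prems by (intro eventually_nhds_in_open[of "{w. Im w > 0}", simplified])
       (auto simp: open_halfspace_Im_gt)
  have "(-1) ^ Suc n * Polygamma (Suc n) (1 - z) - Polygamma (Suc n) z = 
        0 - (2 * of_real pi * \<i>) ^ Suc n * (D * (?q z * (2 * of_real pi * \<i>)))"
  proof (rule DERIV_unique[OF d2])
    show "((\<lambda>z. (-1) ^ n * Polygamma n (1 - z) - Polygamma n z) has_field_derivative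
        0 - (2 * of_real pi * \<i>) ^ Suc n * (D * (?q z * (2 * of_real pi * \<i>)))) (at z)"
      by (rule iffD2[OF DERIV_cong_ev[OF refl _ refl] d1])
         (use ev Suc.IH in \<open>auto elim!: eventually_mono\<close>)
  qed
  also have "\<dots> = - ((2 * of_real pi * \<i>) ^ Suc (Suc n) * (?q z * D))" by simp
  finally show ?case unfolding D(2) by simp
qed

text \<open>
  The two series on the left together are \<open>\<Sum>\<^sub>n 1 / (z + n)\<^sup>w\<close> over all integers \<open>n\<close>, the negative \<open>n\<close>
  being folded into the second one because \<open>w\<close> is even. Each is a polygamma value, so the sum is the
  reflection formula of order \<open>w - 1\<close>.
\<close>
lemma lipschitz_summation_formula:
  fixes z :: complex
  assumes "Im z > 0" "even w" "w > 0"
  shows "(\<Sum>k. 1 / (z + of_nat k) ^ w) + (\<Sum>k. 1 / (1 - z + of_nat k) ^ w) =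
           (2 * of_real pi * \<i>) ^ w / fact (w - 1) *
           (\<Sum>r. of_nat r ^ (w - 1) * exp (2 * of_real pi * \<i> * z) ^ r)"
proof -
  obtain n where n: "w = Suc n" using assms by (cases w) auto
  hence o: "odd n" "n > 0" using assms(2) by (auto simp: odd_pos)
  have "(\<Sum>k. 1 / (x + of_nat k) ^ w) = Polygamma n x / fact n" 
    if "Im x \<noteq> 0" for x :: complex
  proof -
    have "x \<notin> \<int>\<^sub>\<le>\<^sub>0" using that by (auto elim!: nonpos_Ints_cases)
    hence "x \<noteq> 0" by auto
    from sums_unique[OF Polygamma_LIMSEQ[OF this \<open>n > 0\<close>]] o show ?thesis
      by (simp add: n field_simps)
  qed
  from this[of z] this[of "1 - z"]
  have "(\<Sum>k. 1 / (z + of_nat k) ^ w) + (\<Sum>k. 1 / (1 - z + of_nat k) ^ w) =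
         - ((-1) ^ n * Polygamma n (1 - z) - Polygamma n z) / fact n"
    using assms o by (simp add: add_divide_distrib)
  also have "\<dots> = (2 * of_real pi * \<i>) ^ w / fact (w - 1) *
           (\<Sum>r. of_nat r ^ (w - 1) * exp (2 * of_real pi * \<i> * z) ^ r)"
    unfolding Polygamma_reflection[OF assms(1)] using n o by simp
  finally show ?thesis .
qed

section \<open>Even zeta values and Bernoulli numbers\<close>

text \<open>
  The defining identity of the Bernoulli numbers, moved to the complex numbers and rescaled by \<open>c\<close>. The value
  needed is \<open>c = 2 \<pi> \<i>\<close>, for which \<open>fps_exp c\<close> is the expansion of \<open>exp (2 \<pi> \<i> z)\<close>.
\<close>
lemma bernoulli_egf_times_exp_minus_one:
  fixes c :: complex
  shows "Abs_fps (\<lambda>n. of_real (bernoulli n) / fact n * c ^ n) * (fps_exp c - 1) = fps_const c * fps_X"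
proof (rule fps_ext)
  fix n
  let ?B = "fps_X / (fps_exp 1 - 1) :: real fps"
  have ne: "fps_exp 1 - 1 \<noteq> (0 :: real fps)"
    by (auto simp: fps_eq_iff intro!: exI[of _ 1])
  have sd: "subdegree (fps_exp 1 - 1 :: real fps) = 1"
    by (rule subdegreeI) auto
  have "?B * (fps_exp 1 - 1) = fps_X"
    using ne sd by (intro fps_times_divide_eq) auto
  hence "of_real ((?B * (fps_exp 1 - 1)) $ n) = (of_real (fps_nth fps_X n) :: complex)"
    by (rule arg_cong)
  hence B: "(\<Sum>i=0..n. of_real (?B $ i) * (1 / fact (n - i) - (if n - i = 0 then 1 else 0))) = 
     (if n = 1 then 1 else 0 :: complex)"
    by (simp add: fps_mult_nth fps_X_def if_distrib cong: if_cong)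
  have "(Abs_fps (\<lambda>n. of_real (bernoulli n) / fact n * c ^ n) * (fps_exp c - 1)) $ n =
    (\<Sum>i=0..n. of_real (?B $ i) * (1 / fact (n - i) - (if n - i = 0 then 1 else 0)) * c ^ n)"
    unfolding fps_mult_nth
    by (intro sum.cong refl) (auto simp: bernoulli_def power_add[symmetric] algebra_simps diff_divide_distrib)
  also have "\<dots> = (if n = 1 then 1 else 0) * c ^ n"
    unfolding sum_distrib_right[symmetric] B ..
  also have "\<dots> = (fps_const c * fps_X) $ n" by (cases "n = 1") auto
  finally show "(Abs_fps (\<lambda>n. of_real (bernoulli n) / fact n * c ^ n) * (fps_exp c - 1)) $ n = 
    (fps_const c * fps_X) $ n" .
qed

text \<open>
  The first factor is \<open>\<pi> z cot (\<pi> z) - \<i> \<pi> z\<close>, written with \<open>Digamma (1 + z)\<close> in place of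
  \<open>Digamma z\<close> so that it is holomorphic at \<open>0\<close> and can be compared with a power series there.
\<close>
lemma Digamma_diff_times_exp_minus_one:
  fixes z :: complex
  assumes "norm z < 1"
  shows "(z * (Digamma (1 - z) - Digamma (1 + z)) + 1 - \<i> * of_real pi * z) *
           (exp (2 * of_real pi * \<i> * z) - 1) = 2 * of_real pi * \<i> * z"
proof (cases "z = 0")
  case False
  have Z: "z \<notin> \<int>"
  proof
    assume "z \<in> \<int>"
    then obtain n where "z = of_int n" by (elim Ints_cases)
    with assms False show False by simp
  qed
  hence s: "sin (of_real pi * z) \<noteq> 0"
    by (auto simp: sin_eq_0 mult.commute)
  have e: "exp (2 * of_real pi * \<i> * z) \<noteq> 1"
  proof
    assume "exp (2 * of_real pi * \<i> * z) = 1"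
    then obtain n :: int where n: "Im (2 * of_real pi * \<i> * z) = of_int (2 * n) * pi" 
        "Re (2 * of_real pi * \<i> * z) = 0"
      unfolding exp_eq_1 by blast
    hence "z = of_int n" by (auto simp: complex_eq_iff)
    with Z show False by simp
  qed
  have "Digamma (1 + z) = Digamma z + 1 / z"
    using Digamma_plus1[OF False] by (simp add: add.commute)
  moreover have "Digamma (1 - z) = Digamma z + (\<i> * of_real pi + 2 * \<i> * of_real pi / (exp (2 * of_real pi * \<i> * z) - 1))"
    using Digamma_reflection[OF Z] pi_cot_eq_nome[OF s] by (simp add: algebra_simps)
  ultimately have "z * (Digamma (1 - z) - Digamma (1 + z)) + 1 - \<i> * of_real pi * z =
      z * (2 * \<i> * of_real pi / (exp (2 * of_real pi * \<i> * z) - 1))"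
    using False by (simp add: ring_distribs)
  with e show ?thesis by simp
qed auto

text \<open>
  Euler's formula. The function \<open>z (Digamma (1 - z) - Digamma (1 + z)) + 1 - \<i> \<pi> z\<close> satisfies the equation
  that characterises the exponential generating function of the Bernoulli numbers at \<open>2 \<pi> \<i> z\<close>, while its
  Taylor coefficients are polygamma values at \<open>1\<close>, that is, zeta values.
\<close>
lemma zeta_even_eq_bernoulli:
  assumes "even w" "w > 0"
  shows "2 * (\<Sum>k. 1 / of_nat (Suc k) ^ w) = 
           - of_real (bernoulli w) / fact w * (2 * of_real pi * \<i> :: complex) ^ w"
proof -
  obtain n where n: "w = Suc n" using assms by (cases w) auto
  hence o: "odd n" "n > 0" using assms(1) by (auto simp: odd_pos)
  define c :: complex where "c = 2 * of_real pi * \<i>"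
  define f where "f = (\<lambda>z::complex. Digamma (1 - z) - Digamma (1 + z))"
  have "f field_differentiable at z" if "z \<in> ball 0 1" for z
    unfolding f_def field_differentiable_def
    using one_plus_notin_nonpos_Ints[of z] one_plus_notin_nonpos_Ints[of "-z"] that by (auto intro!: derivative_eq_intros exI)
  hence holo: "f holomorphic_on ball 0 1"
    by (auto simp: holomorphic_on_def intro: field_differentiable_at_within)
  have F: "f has_fps_expansion fps_expansion f 0"
    by (rule has_fps_expansion_fps_expansion[OF _ _ holo]) auto
  have "(\<lambda>z. (z * f z + 1 - c / 2 * z) * (exp (c * z) - 1)) has_fps_expansion 
     (fps_X * fps_expansion f 0 + 1 - fps_const (c / 2) * fps_X) * (fps_exp c - 1)"
    by (intro fps_expansion_intros F)
  moreover have "(\<lambda>z. c * z) has_fps_expansion (fps_const c * fps_X)"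
    by (intro fps_expansion_intros)
  moreover have "eventually (\<lambda>z. z \<in> ball 0 1) (nhds (0::complex))"
    by (rule eventually_nhds_in_open) auto
  hence "eventually (\<lambda>z. c * z = (z * f z + 1 - c / 2 * z) * (exp (c * z) - 1)) (nhds 0)"
  proof (rule eventually_mono)
    fix z :: complex assume "z \<in> ball 0 1"
    thus "c * z = (z * f z + 1 - c / 2 * z) * (exp (c * z) - 1)"
      using Digamma_diff_times_exp_minus_one[of z] by (simp add: f_def c_def mult_ac)
  qed
  hence "((\<lambda>z. c * z) has_fps_expansion (fps_const c * fps_X)) \<longleftrightarrow>
     (\<lambda>z. (z * f z + 1 - c / 2 * z) * (exp (c * z) - 1)) has_fps_expansion (fps_const c * fps_X)"
    by (rule has_fps_expansion_cong) simp
  ultimately have "(fps_X * fps_expansion f 0 + 1 - fps_const (c / 2) * fps_X) * (fps_exp c - 1) =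
      fps_const c * fps_X"
    using fps_expansion_unique_complex by blast
  also have "\<dots> = Abs_fps (\<lambda>n. of_real (bernoulli n) / fact n * c ^ n) * (fps_exp c - 1)"
    by (rule bernoulli_egf_times_exp_minus_one[symmetric])
  finally have "fps_X * fps_expansion f 0 + 1 - fps_const (c / 2) * fps_X =
      Abs_fps (\<lambda>n. of_real (bernoulli n) / fact n * c ^ n)"
  proof (subst (asm) mult_cancel_right, elim disjE)
    assume "fps_exp c - 1 = 0"
    hence "(fps_exp c - 1) $ 1 = 0" by simp
    thus ?thesis by (simp add: c_def)
  qed
  hence "(fps_X * fps_expansion f 0 + 1 - fps_const (c / 2) * fps_X) $ w =
      Abs_fps (\<lambda>n. of_real (bernoulli n) / fact n * c ^ n) $ w" by simp
  hence "fps_expansion f 0 $ n = of_real (bernoulli w) / fact w * c ^ w"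
    using o by (simp add: n)
  moreover have "fps_expansion f 0 $ n = - 2 * (Polygamma n 1 / fact n)"
    using higher_deriv_Digamma_diff[of 0 n] o by (simp add: fps_expansion_def f_def)
  moreover have "(\<Sum>k. 1 / of_nat (Suc k) ^ w) = (Polygamma n 1 / fact n :: complex)"
    using sums_unique[OF zeta_sums_Polygamma_1[OF \<open>n > 0\<close>]] o by (simp add: n)
  ultimately show ?thesis unfolding c_def by simp (metis minus_minus)
qed

lemma zeta_nonzero:
  assumes "w > 1"
  shows "(\<Sum>k. 1 / of_nat (Suc k) ^ w :: complex) \<noteq> 0"
proof -
  obtain n where n: "w = Suc n" "n > 0" using assms by (cases w) auto
  have s: "summable (\<lambda>k. 1 / of_nat (Suc k) ^ w :: real)"
    using Polygamma_LIMSEQ[of "1::real" n] n by (auto simp: field_simps sums_iff)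
  have "(\<Sum>k. 1 / of_nat (Suc k) ^ w :: complex) = of_real (\<Sum>k. 1 / of_nat (Suc k) ^ w)"
    by (subst suminf_of_real[OF s]) simp
  moreover have "(\<Sum>k. 1 / of_nat (Suc k) ^ w :: real) > 0"
    by (rule suminf_pos[OF s]) simp
  ultimately show ?thesis by simp
qed

lemma bernoulli_even_nonzero:
  assumes "even w" "w > 0"
  shows "bernoulli w \<noteq> 0"
proof -
  have "w > 1" using assms by (auto elim!: evenE)
  from zeta_nonzero[OF this] zeta_even_eq_bernoulli[OF assms] show ?thesis by auto
qed

section \<open>The lattice sum and its modularity\<close>

lemma infsum_UNIV_nat_eq_suminf:
  fixes f :: "nat \<Rightarrow> 'a :: {topological_comm_monoid_add, t2_space}"
  assumes "f summable_on UNIV"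
  shows "infsum f UNIV = suminf f"
  using has_sum_imp_sums[OF has_sum_infsum[OF assms]] by (simp add: sums_iff)

lemma int_UNIV_split: "(UNIV :: int set) = range int \<union> range (\<lambda>k. - 1 - int k)"
proof -
  have "x \<in> range int \<union> range (\<lambda>k. - 1 - int k)" for x :: int
  proof (cases "x \<ge> 0")
    case True
    thus ?thesis by (auto intro: range_eqI[of _ _ "nat x"])
  next
    case False
    hence "x = - 1 - int (nat (- 1 - x))" by simp
    thus ?thesis by blast
  qed
  thus ?thesis by blast
qed

lemma summable_on_int_iff:
  fixes g :: "int \<Rightarrow> 'a :: banach"
  shows "g summable_on UNIV \<longleftrightarrow>
           (\<lambda>k. g (int k)) summable_on UNIV \<and> (\<lambda>k. g (- 1 - int k)) summable_on UNIV"
proof -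
  have "g summable_on UNIV \<longleftrightarrow> g summable_on range int \<and> g summable_on range (\<lambda>k. - 1 - int k)"
    by (subst int_UNIV_split)
       (auto intro!: summable_on_Un_disjoint intro: summable_on_subset_banach)
  thus ?thesis by (simp add: summable_on_reindex inj_on_def o_def)
qed

lemma infsum_int_split:
  fixes g :: "int \<Rightarrow> 'a :: banach"
  assumes "g summable_on UNIV"
  shows "infsum g UNIV = (\<Sum>k. g (int k)) + (\<Sum>k. g (- 1 - int k))"
proof -
  have s: "(\<lambda>k. g (int k)) summable_on UNIV" "(\<lambda>k. g (- 1 - int k)) summable_on UNIV"
    using assms summable_on_int_iff by blast+
  have "infsum g UNIV = infsum g (range int \<union> range (\<lambda>k. - 1 - int k))"
    by (simp only: int_UNIV_split[symmetric])
  also have "\<dots> = infsum g (range int) + infsum g (range (\<lambda>k. - 1 - int k))"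
    using assms by (intro infsum_Un_disjoint) (auto intro: summable_on_subset_banach)
  also have "\<dots> = infsum (\<lambda>k. g (int k)) UNIV + infsum (\<lambda>k. g (- 1 - int k)) UNIV"
    by (simp add: infsum_reindex inj_on_def o_def)
  finally show ?thesis using s by (simp add: infsum_UNIV_nat_eq_suminf)
qed

lemma infsum_int_even:
  fixes g :: "int \<Rightarrow> complex"
  assumes "g summable_on UNIV" "\<And>m. g (- m) = g m"
  shows "infsum g UNIV = g 0 + 2 * (\<Sum>k. g (int (Suc k)))"
proof -
  have s: "summable (\<lambda>k. g (int k))"
    using assms(1) summable_on_int_iff summable_on_imp_summable by blast
  have "(\<Sum>k. g (int k)) = g 0 + (\<Sum>k. g (int (Suc k)))"
    using suminf_split_head[OF s] by simp
  moreover have "g (- 1 - int k) = g (int (Suc k))" for k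
    using assms(2)[of "int (Suc k)"] by (simp add: algebra_simps)
  ultimately show ?thesis by (simp add: infsum_int_split[OF assms(1)])
qed

lemma summable_on_inverse_squares_int:
  "(\<lambda>m::int. 1 / (max 1 (real_of_int \<bar>m\<bar>))\<^sup>2) summable_on UNIV"
proof -
  have s: "summable (\<lambda>k. 1 / (real (Suc k))\<^sup>2)"
    using inverse_power_summable[of 2, where ?'a = real] 
    by (subst summable_Suc_iff) (simp add: field_simps)
  have "(\<lambda>k. 1 / (max 1 (real_of_int \<bar>- 1 - int k\<bar>))\<^sup>2) = (\<lambda>k. 1 / (real (Suc k))\<^sup>2)"
    by (auto simp: fun_eq_iff)
  moreover have "summable (\<lambda>k. 1 / (max 1 (real_of_int \<bar>int k\<bar>))\<^sup>2)"
  proof (subst summable_Suc_iff[symmetric])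
    have "(\<lambda>k. 1 / (max 1 (real_of_int \<bar>int (Suc k)\<bar>))\<^sup>2) = (\<lambda>k. 1 / (real (Suc k))\<^sup>2)"
      by (auto simp: fun_eq_iff)
    thus "summable (\<lambda>k. 1 / (max 1 (real_of_int \<bar>int (Suc k)\<bar>))\<^sup>2)" using s by simp
  qed
  ultimately show ?thesis
    using s by (subst summable_on_int_iff) (simp add: summable_on_UNIV_nonneg_real_iff)
qed

text \<open>
  The imaginary part of \<open>m z + n\<close> controls \<open>m\<close>, and then the triangle inequality controls \<open>n\<close>.
\<close>
lemma lattice_norm_bound:
  fixes z :: complex
  assumes "Im z > 0" 
  obtains K where "K > 0" 
    "\<And>m n :: int. max (real_of_int \<bar>m\<bar>) (real_of_int \<bar>n\<bar>) \<le> K * norm (of_int m * z + of_int n)"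
proof
  let ?K = "1 + (1 + norm z) / Im z"
  show "?K > 0" using assms by (auto intro!: add_pos_nonneg divide_nonneg_pos)
  fix m n :: int
  let ?x = "of_int m * z + of_int n"
  have "\<bar>Im ?x\<bar> \<le> norm ?x" by (rule abs_Im_le_cmod)
  hence "\<bar>of_int m\<bar> * Im z \<le> norm ?x" using assms by (simp add: abs_mult)
  hence m: "\<bar>of_int m\<bar> \<le> norm ?x / Im z" using assms by (simp add: field_simps)
  also have "\<dots> \<le> norm ?x / Im z + (norm ?x + norm z * norm ?x / Im z)"
    using assms by simp
  also have "\<dots> = ?K * norm ?x"
    by (simp add: ring_distribs add_divide_distrib)
  finally have 1: "\<bar>of_int m\<bar> \<le> ?K * norm ?x" .
  have "norm (of_int n :: complex) \<le> norm ?x + norm (of_int m * z)"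
    using norm_triangle_ineq4[of ?x "of_int m * z"] by simp
  hence "\<bar>of_int n\<bar> \<le> norm ?x + \<bar>of_int m\<bar> * norm z" by (simp add: norm_mult)
  also have "\<bar>of_int m\<bar> * norm z \<le> norm ?x / Im z * norm z"
    by (rule mult_right_mono[OF m]) simp
  also have "norm ?x + norm ?x / Im z * norm z \<le> norm ?x + norm ?x / Im z * norm z + norm ?x / Im z"
    using assms by simp
  also have "\<dots> = ?K * norm ?x"
    by (simp add: ring_distribs add_divide_distrib)
  finally show "max (real_of_int \<bar>m\<bar>) (real_of_int \<bar>n\<bar>) \<le> ?K * norm ?x" using 1 by simp
qed

text \<open>
  Away from the origin the maximum \<open>M\<close> of \<open>\<bar>m\<bar>\<close> and \<open>\<bar>n\<bar>\<close> is at least \<open>1\<close>, so for weight at least \<open>4\<close> the power \<open>M\<^sup>w\<close>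
  dominates \<open>max 1 m\<^sup>2 * max 1 n\<^sup>2\<close>. The majorant is thus a product of two convergent series over the integers.
\<close>
lemma eisenstein_lattice_summable:
  fixes z :: complex
  assumes "Im z > 0" "w \<ge> 4"
  shows "(\<lambda>(m::int,n::int). 1 / (of_int m * z + of_int n) ^ w) summable_on UNIV"
proof -
  let ?h = "\<lambda>m::int. 1 / (max 1 (real_of_int \<bar>m\<bar>))\<^sup>2"
  let ?f = "\<lambda>(m::int,n::int). 1 / (of_int m * z + of_int n) ^ w"
  obtain K where K: "K > 0" 
    "\<And>m n :: int. max (real_of_int \<bar>m\<bar>) (real_of_int \<bar>n\<bar>) \<le> K * norm (of_int m * z + of_int n)"
    using lattice_norm_bound[OF assms(1)] by blast
  have "(\<lambda>(m,n). ?h m * ?h n) summable_on Sigma UNIV (\<lambda>_. UNIV)"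
  proof (rule summable_on_SigmaI)
    show "((\<lambda>y. case (m, y) of (m, n) \<Rightarrow> ?h m * ?h n) has_sum ?h m * infsum ?h UNIV) UNIV" for m
      using has_sum_cmult_right[OF has_sum_infsum[OF summable_on_inverse_squares_int], of "?h m"] by simp
    show "(\<lambda>m. ?h m * infsum ?h UNIV) summable_on UNIV"
      by (intro summable_on_cmult_left summable_on_inverse_squares_int)
  qed auto
  hence "(\<lambda>x. K ^ w * (case x of (m,n) \<Rightarrow> ?h m * ?h n)) summable_on UNIV"
    by (intro summable_on_cmult_right) simp
  hence "(\<lambda>x. norm (?f x)) summable_on UNIV"
  proof (rule Infinite_Sum.abs_summable_on_comparison_test')
    fix x :: "int \<times> int"
    obtain m n where x: "x = (m, n)" by (cases x)
    let ?X = "norm (of_int m * z + of_int n)"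
    show "norm (?f x) \<le> K ^ w * (case x of (m,n) \<Rightarrow> ?h m * ?h n)"
    proof (cases "m = 0 \<and> n = 0")
      \<comment> \<open>the term of the origin is \<open>1 / 0 = 0\<close>\<close>
      case True
      thus ?thesis using assms(2) K(1) x by (simp add: power_0_left)
    next
      case False
      define a where "a = max 1 (real_of_int \<bar>m\<bar>)"
      define b where "b = max 1 (real_of_int \<bar>n\<bar>)"
      define M where "M = K * ?X"
      have ab: "a \<ge> 1" "b \<ge> 1" by (simp_all add: a_def b_def)
      have "1 \<le> max (real_of_int \<bar>m\<bar>) (real_of_int \<bar>n\<bar>)"
        using False by linarith
      hence M: "1 \<le> M" "a \<le> M" "b \<le> M" using K(2)[of m n] unfolding M_def a_def b_def by auto
      have "a\<^sup>2 * b\<^sup>2 \<le> M\<^sup>2 * M\<^sup>2"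
        using ab M by (intro mult_mono power_mono) auto
      also have "\<dots> = M ^ 4" by (simp add: power_add[symmetric])
      also have "\<dots> \<le> M ^ w" using M assms by (intro power_increasing) auto
      finally have *: "a\<^sup>2 * b\<^sup>2 \<le> K ^ w * ?X ^ w" by (simp add: M_def power_mult_distrib)
      have "0 < K * ?X" using M(1) unfolding M_def by linarith
      hence "?X > 0" using K(1) zero_less_mult_pos by blast
      hence "?X ^ w > 0" by simp
      moreover have "a\<^sup>2 * b\<^sup>2 > 0" using ab by simp
      ultimately have "1 / ?X ^ w \<le> K ^ w * (1 / a\<^sup>2 * (1 / b\<^sup>2))"
        using * by (simp add: field_simps)
      thus ?thesis by (simp add: x a_def b_def norm_divide norm_power)
    qed
  qed
  thus ?thesis by (rule abs_summable_summable)
qed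

text \<open>
  The non-normalised Eisenstein series \<open>G\<^sub>w\<close>. Division by zero gives the origin the value \<open>0\<close> for \<open>w > 0\<close>, so the
  sum may run over the whole lattice.
\<close>
definition lattice_sum :: "nat \<Rightarrow> complex \<Rightarrow> complex" where
  "lattice_sum w z = (\<Sum>\<^sub>\<infinity>(m::int,n::int)\<in>UNIV. 1 / (of_int m * z + of_int n) ^ w)"

text \<open>
  A matrix of determinant \<open>1\<close> permutes the lattice of pairs \<open>(m, n)\<close>.
\<close>
lemma lattice_sum_modular:
  fixes a b c d :: int
  assumes "a * d - b * c = 1" "of_int c * z + of_int d \<noteq> 0"
  shows "lattice_sum w ((of_int a * z + of_int b) / (of_int c * z + of_int d)) = 
           (of_int c * z + of_int d) ^ w * lattice_sum w z"
proof -
  let ?j = "of_int c * z + of_int d"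
  have "lattice_sum w ((of_int a * z + of_int b) / ?j) =
     (\<Sum>\<^sub>\<infinity>(m::int,n::int)\<in>UNIV. ?j ^ w * (1 / (of_int m * z + of_int n) ^ w))"
    unfolding lattice_sum_def
  proof (rule infsum_reindex_bij_witness[where j = "\<lambda>(m, n). (m * a + n * c, m * b + n * d)" 
         and i = "\<lambda>(m, n). (m * d - n * c, n * a - m * b)"], goal_cases)
    case (1 x)
    obtain m n where x: "x = (m, n)" by (cases x)
    have "(m * a + n * c) * d - (m * b + n * d) * c = m * (a * d - b * c)"
         "(m * b + n * d) * a - (m * a + n * c) * b = n * (a * d - b * c)" by (auto simp: algebra_simps)
    thus ?case by (simp add: x assms(1))
  next
    case (3 x)
    obtain m n where x: "x = (m, n)" by (cases x)
    have "(m * d - n * c) * a + (n * a - m * b) * c = m * (a * d - b * c)"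
         "(m * d - n * c) * b + (n * a - m * b) * d = n * (a * d - b * c)" by (auto simp: algebra_simps)
    thus ?case by (simp add: x assms(1))
  next
    case (5 x)
    obtain m n where x: "x = (m, n)" by (cases x)
    have "of_int m * ((of_int a * z + of_int b) / ?j) + of_int n = 
           (of_int (m * a + n * c) * z + of_int (m * b + n * d)) / ?j"
      using assms(2) by (simp add: divide_simps) (simp add: algebra_simps)
    thus ?case by (simp add: x power_divide)
  qed auto
  also have "\<dots> = ?j ^ w * lattice_sum w z"
    unfolding lattice_sum_def infsum_cmult_right'[symmetric] by (simp add: case_prod_unfold)
  finally show ?thesis .
qed

section \<open>The Fourier expansion of the lattice sum\<close>

lemma divisor_sigma_of_nat:
  assumes "n > 0"
  shows "divisor_sigma j (of_nat n) = (\<Sum>d | d dvd n. d ^ j)"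
  using assms by (simp add: divisor_sigma_def)

lemma divisor_sigma_le:
  assumes "n > 0"
  shows "divisor_sigma j (of_nat n) \<le> n ^ Suc j"
proof -
  have "divisor_sigma j (of_nat n) \<le> (\<Sum>d\<in>{1..n}. d ^ j)"
    unfolding divisor_sigma_of_nat[OF assms]
    using assms by (intro sum_mono2) (auto intro: dvd_imp_le Nat.gr0I)
  also have "\<dots> \<le> of_nat (card {1..n}) * n ^ j"
    by (intro sum_bounded_above power_mono) auto
  finally show ?thesis by simp
qed

lemma summable_norm_power_times_geometric:
  fixes q :: complex
  assumes "norm q < 1"
  shows "summable (\<lambda>n. norm (of_nat n ^ j * q ^ n))"
  using summable_power_times_geometric[of "of_real (norm q)" j] assms
    summable_of_real_iff[of "\<lambda>n. real n ^ j * norm q ^ n", where ?'a = complex]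
  by (simp add: norm_mult norm_power)

lemma summable_norm_divisor_sigma:
  fixes q :: complex
  assumes "norm q < 1"
  shows "summable (\<lambda>n. norm (of_nat (divisor_sigma j (of_nat (Suc n))) * q ^ Suc n))"
proof (rule summable_comparison_test)
  show "summable (\<lambda>n. norm (of_nat (Suc n) ^ Suc j * q ^ Suc n))"
    using summable_norm_power_times_geometric[OF assms, of "Suc j"] by (subst summable_Suc_iff)
  have "real (divisor_sigma j (of_nat (Suc n))) \<le> real (Suc n ^ Suc j)" for n
    using divisor_sigma_le[of "Suc n" j] by (subst of_nat_le_iff) simp
  hence "real (divisor_sigma j (of_nat (Suc n))) * norm q ^ Suc n \<le> real (Suc n ^ Suc j) * norm q ^ Suc n" for n
    by (rule mult_right_mono) simp
  thus "\<exists>N. \<forall>n\<ge>N. norm (norm (of_nat (divisor_sigma j (of_nat (Suc n))) * q ^ Suc n)) 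
           \<le> norm (of_nat (Suc n) ^ Suc j * q ^ Suc n)"
    unfolding norm_mult norm_power by (intro exI[of _ 0]) (simp del: of_nat_Suc power_Suc)
qed

text \<open>
  Grouping the pairs \<open>(k, r)\<close> by the product \<open>(k + 1) r = n + 1\<close> turns the double series into
  a sum over \<open>n\<close> and the divisors \<open>r\<close> of \<open>n + 1\<close>. The rearrangement is legitimate because the grouped series is
  absolutely convergent.
\<close>
lemma lambert_series_divisor_sigma:
  fixes q :: complex
  assumes "norm q < 1" "j > 0"
  shows "(\<lambda>k. \<Sum>r. of_nat r ^ j * (q ^ Suc k) ^ r) sums
           (\<Sum>n. of_nat (divisor_sigma j (of_nat (Suc n))) * q ^ Suc n)"
proof -
  let ?D = "\<lambda>n. {d. d dvd Suc n}"
  let ?f = "\<lambda>(n::nat, d::nat). of_nat d ^ j * q ^ Suc n"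
  let ?g = "\<lambda>(k, r). of_nat r ^ j * (q ^ Suc k) ^ r"
  have inner: "infsum (\<lambda>d. ?f (n, d)) (?D n) = of_nat (divisor_sigma j (of_nat (Suc n))) * q ^ Suc n" for n
    by (subst infsum_finite) (auto simp: divisor_sigma_of_nat sum_distrib_right simp del: of_nat_Suc)
  have inner': "infsum (\<lambda>d. norm (?f (n, d))) (?D n) = 
                 norm (of_nat (divisor_sigma j (of_nat (Suc n))) * q ^ Suc n)" for n
    unfolding norm_mult norm_power norm_of_nat divisor_sigma_of_nat[OF zero_less_Suc]
    by (subst infsum_finite) (auto simp: sum_distrib_right norm_mult norm_power simp del: of_nat_Suc)
  have s: "(\<lambda>n. norm (of_nat (divisor_sigma j (of_nat (Suc n))) * q ^ Suc n)) summable_on UNIV"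
    using summable_norm_divisor_sigma[OF assms(1), of j] by (subst summable_on_UNIV_nonneg_real_iff) auto
  have "(\<lambda>x. norm (?f x)) summable_on Sigma UNIV ?D"
    unfolding Infinite_Sum.abs_summable_on_Sigma_iff inner' using s by auto
  hence f: "?f summable_on Sigma UNIV ?D" by (rule abs_summable_summable)
  \<comment> \<open>the term with \<open>r = 0\<close> vanishes and is left out, as it belongs to no \<open>n\<close>\<close>
  have bij: "bij_betw (\<lambda>(k, r). (Suc k * r - 1, r)) (UNIV \<times> {1..}) (Sigma UNIV ?D)"
  proof (rule bij_betwI[where g = "\<lambda>(n, d). (Suc n div d - 1, d)"], goal_cases)
    case (2)
    show ?case by (auto simp: Suc_le_eq intro: dvd_pos_nat[OF zero_less_Suc])
  next
    case (4 x)
    obtain n d where x: "x = (n, d)" by (cases x)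
    hence "d dvd Suc n" using 4 by simp
    then obtain e where e: "Suc n = d * e" by blast
    hence "d > 0" "e > 0" by (auto intro!: Nat.gr0I)
    hence "Suc (Suc n div d - 1) = e" using e by simp
    hence "Suc (Suc n div d - 1) * d - 1 = n" using e by (simp add: mult.commute del: mult_Suc mult_Suc_right)
    thus ?case by (simp only: x prod.case)
  qed auto
  have eq: "?f (case x of (k, r) \<Rightarrow> (Suc k * r - 1, r)) = ?g x" if "x \<in> UNIV \<times> {1..}" for x
  proof -
    obtain k r where x: "x = (k, r)" by (cases x)
    hence "Suc (Suc k * r - 1) = Suc k * r" using that by simp
    thus ?thesis by (simp only: x prod.case power_mult)
  qed
  have g: "?g summable_on UNIV \<times> {1..}"
    using f summable_on_reindex_bij_betw[OF bij, of ?f] eq by (metis (no_types, lifting) summable_on_cong)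
  have gg: "infsum ?g (UNIV \<times> {1..}) = infsum ?f (Sigma UNIV ?D)"
    using infsum_reindex_bij_betw[OF bij, of ?f] eq by (metis (no_types, lifting) infsum_cong)
  have r: "infsum (\<lambda>r. ?g (k, r)) {1..} = (\<Sum>r. of_nat r ^ j * (q ^ Suc k) ^ r)" for k
  proof -
    have q: "norm (q ^ Suc k) < 1" using assms(1) by (simp add: norm_power power_less_one_iff del: power_Suc)
    have "(\<lambda>r. of_nat r ^ j * (q ^ Suc k) ^ r) summable_on UNIV"
      using summable_norm_power_times_geometric[OF q] by (rule norm_summable_imp_summable_on)
    hence "(\<Sum>r. of_nat r ^ j * (q ^ Suc k) ^ r) = infsum (\<lambda>r. of_nat r ^ j * (q ^ Suc k) ^ r) UNIV"
      by (rule infsum_UNIV_nat_eq_suminf[symmetric])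
    also have "infsum (\<lambda>r. of_nat r ^ j * (q ^ Suc k) ^ r) UNIV = infsum (\<lambda>r. ?g (k, r)) {1..}"
      using assms(2) by (intro infsum_cong_neutral) (auto simp: not_le)
    finally show ?thesis ..
  qed
  have "(\<lambda>k. infsum (\<lambda>r. ?g (k, r)) {1..}) summable_on UNIV"
    using summable_on_Sigma_banach[of "\<lambda>k r. ?g (k, r)"] g by simp
  hence "(\<lambda>k. \<Sum>r. of_nat r ^ j * (q ^ Suc k) ^ r) sums infsum (\<lambda>k. infsum (\<lambda>r. ?g (k, r)) {1..}) UNIV"
    unfolding r by (intro has_sum_imp_sums has_sum_infsum)
  also have "infsum (\<lambda>k. infsum (\<lambda>r. ?g (k, r)) {1..}) UNIV = infsum ?g (UNIV \<times> {1..})" using g by (rule infsum_Sigma_banach)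
  also note gg
  also have "infsum ?f (Sigma UNIV ?D) = infsum (\<lambda>n. infsum (\<lambda>d. ?f (n, d)) (?D n)) UNIV"
    using f by (rule infsum_Sigma_banach[symmetric])
  also have "\<dots> = (\<Sum>n. of_nat (divisor_sigma j (of_nat (Suc n))) * q ^ Suc n)"
    unfolding inner using abs_summable_summable[OF s] by (rule infsum_UNIV_nat_eq_suminf)
  finally show ?thesis .
qed

text \<open>
  Summing over \<open>n\<close> first, the row \<open>m = 0\<close> of the lattice contributes \<open>2 \<zeta>(w)\<close> and each row \<open>m \<noteq> 0\<close> is a case of the Lipschitz
  formula at \<open>m z\<close>; the rows \<open>m\<close> and \<open>- m\<close> agree. The resulting Lambert series is that of \<open>\<sigma>\<^bsub>w-1\<^esub>\<close>, and Euler's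
  formula for \<open>\<zeta>(w)\<close> produces the factor \<open>2 w / B\<^sub>w\<close>.
\<close>
lemma eisenstein_eq_lattice_sum:
  fixes z :: complex
  assumes "Im z > 0" "even w" "w \<ge> 4"
  shows "eisenstein w z = lattice_sum w z / (2 * (\<Sum>k. 1 / of_nat (Suc k) ^ w))"
proof -
  define q where "q = exp (2 * of_real pi * \<i> * z)"
  define c where "c = (2 * of_real pi * \<i> :: complex)"
  define \<zeta> where "\<zeta> = (\<Sum>k. 1 / of_nat (Suc k) ^ w :: complex)"
  define S where "S = (\<Sum>n. of_nat (divisor_sigma (w - 1) (of_nat (Suc n))) * q ^ Suc n)"
  have q: "norm q < 1" unfolding q_def using norm_nome_width_1_less_1[OF assms(1)] .
  let ?f = "\<lambda>(m::int,n::int). 1 / (of_int m * z + of_int n) ^ w"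
  let ?H = "\<lambda>m::int. infsum (\<lambda>n. ?f (m, n)) UNIV"
  have s: "?f summable_on UNIV \<times> UNIV"
    using eisenstein_lattice_summable[OF assms(1,3)] by simp
  have sn: "(\<lambda>n. ?f (m, n)) summable_on UNIV" for m
    using s by (intro summable_on_SigmaD1[of "\<lambda>m n. ?f (m, n)" UNIV "\<lambda>_. UNIV"]) simp_all
  have sH: "?H summable_on UNIV"
    using summable_on_Sigma_banach[of "\<lambda>m n. ?f (m, n)" UNIV "\<lambda>_. UNIV"] s by simp
  have H0: "?H 0 = 2 * \<zeta>"
  proof -
    have "?H 0 = ?f (0, 0) + 2 * (\<Sum>k. ?f (0, int (Suc k)))"
      using assms(2) by (intro infsum_int_even[OF sn]) auto
    thus ?thesis using assms(3) by (simp add: \<zeta>_def)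
  qed
  have Hk: "?H (int (Suc k)) = c ^ w / fact (w - 1) * (\<Sum>r. of_nat r ^ (w - 1) * (q ^ Suc k) ^ r)" for k
  proof -
    let ?z = "of_nat (Suc k) * z"
    have "?H (int (Suc k)) = (\<Sum>j. ?f (int (Suc k), int j)) + (\<Sum>j. ?f (int (Suc k), - 1 - int j))"
      by (rule infsum_int_split[OF sn])
    also have "(\<lambda>j. ?f (int (Suc k), - 1 - int j)) = (\<lambda>j. 1 / (1 - ?z + of_nat j) ^ w)"
    proof
      fix j
      have "1 - ?z + of_nat j = - (of_int (int (Suc k)) * z + of_int (- 1 - int j))" by simp
      thus "?f (int (Suc k), - 1 - int j) = 1 / (1 - ?z + of_nat j) ^ w"
        using assms(2) by (metis (no_types, lifting) case_prod_conv power_minus_even)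
    qed
    also have "(\<lambda>j. ?f (int (Suc k), int j)) = (\<lambda>j. 1 / (?z + of_nat j) ^ w)" by simp
    also have "(\<Sum>j. 1 / (?z + of_nat j) ^ w) + (\<Sum>j. 1 / (1 - ?z + of_nat j) ^ w) =
        c ^ w / fact (w - 1) * (\<Sum>r. of_nat r ^ (w - 1) * exp (2 * of_real pi * \<i> * ?z) ^ r)"
      unfolding c_def using assms by (intro lipschitz_summation_formula) (auto simp del: of_nat_Suc)
    also have "exp (2 * of_real pi * \<i> * ?z) = q ^ Suc k"
      unfolding q_def exp_of_nat_mult[symmetric] by (simp add: mult_ac)
    finally show ?thesis .
  qed
  have "(\<lambda>k. \<Sum>r. of_nat r ^ (w - 1) * (q ^ Suc k) ^ r) sums S"
    unfolding S_def using assms(3) by (intro lambert_series_divisor_sigma q) auto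
  hence "(\<lambda>k. ?H (int (Suc k))) sums (c ^ w / fact (w - 1) * S)"
    unfolding Hk by (rule sums_mult)
  hence HS: "(\<Sum>k. ?H (int (Suc k))) = c ^ w / fact (w - 1) * S" by (rule sums_unique[symmetric])
  have "lattice_sum w z = infsum ?f (UNIV \<times> UNIV)" by (simp add: lattice_sum_def)
  also have "\<dots> = infsum ?H UNIV" using s by (rule infsum_Sigma_banach[symmetric])
  also have "\<dots> = ?H 0 + 2 * (\<Sum>k. ?H (int (Suc k)))"
  proof (rule infsum_int_even[OF sH])
    fix m :: int
    show "?H (- m) = ?H m"
    proof (rule infsum_reindex_bij_witness[where i = uminus and j = uminus])
      fix n :: int
      have "of_int m * z + of_int (- n) = - (of_int (- m) * z + of_int n)" by simp
      thus "?f (m, - n) = ?f (- m, n)" using assms(2) by (metis (no_types, lifting) case_prod_conv power_minus_even)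
    qed auto
  qed
  finally have L: "lattice_sum w z = 2 * \<zeta> + 2 * (c ^ w / fact (w - 1) * S)"
    unfolding HS H0 .
  have z0: "\<zeta> \<noteq> 0" unfolding \<zeta>_def using assms by (intro zeta_nonzero) auto
  have B0: "bernoulli w \<noteq> 0" using assms by (intro bernoulli_even_nonzero) auto
  have f: "fact w = of_nat w * (fact (w - 1) :: complex)"
    using assms(3) by (intro fact_reduce) auto
  have zeta: "2 * \<zeta> = - of_real (bernoulli w) / fact w * c ^ w"
    unfolding \<zeta>_def c_def using assms by (intro zeta_even_eq_bernoulli) auto
  have "c ^ w / fact (w - 1) = - (2 * \<zeta>) * (of_nat w / of_real (bernoulli w))"
    unfolding zeta f using assms B0 by (simp add: field_simps)
  hence "lattice_sum w z = 2 * \<zeta> * (1 - 2 * of_nat w / of_real (bernoulli w) * S)"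
    unfolding L by (simp add: algebra_simps)
  also have "1 - 2 * of_nat w / of_real (bernoulli w) * S = eisenstein w z"
    by (simp add: eisenstein_def S_def q_def)
  finally show ?thesis using z0 by (simp add: \<zeta>_def)
qed

lemma moebius_Im:
  fixes a b c d :: int
  assumes "a * d - b * c = 1" "Im z > 0"
  shows "of_int c * z + of_int d \<noteq> 0"
    and "Im ((of_int a * z + of_int b) / (of_int c * z + of_int d)) > 0"
proof -
  show j: "of_int c * z + of_int d \<noteq> 0"
  proof
    assume *: "of_int c * z + of_int d = 0"
    hence "Im (of_int c * z + of_int d) = 0" by simp
    hence "c = 0" using assms by simp
    with * assms show False by simp
  qed
  have "Im ((of_int a * z + of_int b) / (of_int c * z + of_int d)) = 
     of_int (a * d - b * c) * Im z / (norm (of_int c * z + of_int d))\<^sup>2"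
    unfolding Im_complex_div_eq_0 Im_divide cmod_power2 by (simp add: algebra_simps)
  also have "\<dots> > 0" using assms j by simp
  finally show "Im ((of_int a * z + of_int b) / (of_int c * z + of_int d)) > 0" .
qed

lemma eisenstein_modular:
  fixes a b c d :: int
  assumes "a * d - b * c = 1" "Im z > 0" "even w" "w \<ge> 4"
  shows "eisenstein w ((of_int a * z + of_int b) / (of_int c * z + of_int d)) = 
           (of_int c * z + of_int d) ^ w * eisenstein w z"
  using assms moebius_Im[OF assms(1,2)]
  by (simp add: eisenstein_eq_lattice_sum lattice_sum_modular)

section \<open>A linear system indexed by the divisors of a square-free number\<close>

lemma prime_factors_prod_primes:
  fixes S :: "nat set"
  assumes "finite S" "\<And>p. p \<in> S \<Longrightarrow> prime p"
  shows "prime_factors (\<Prod>S) = S"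
proof -
  have "prime_factorization (\<Prod>S) = mset_set S"
    unfolding prod_unfold_prod_mset using assms
    by (simp, intro prime_factorization_prod_mset_primes) auto
  thus ?thesis using assms by simp
qed

lemma prod_prime_factors_squarefree:
  fixes d :: nat
  assumes "squarefree d"
  shows "\<Prod>(prime_factors d) = d"
proof -
  have d: "d > 0" using assms by (auto intro!: Nat.gr0I)
  have "d = (\<Prod>p\<in>prime_factors d. p ^ multiplicity p d)"
    by (rule prime_factorization_nat[OF d])
  also have "\<dots> = (\<Prod>p\<in>prime_factors d. p)"
  proof (intro prod.cong refl)
    fix p assume p: "p \<in> prime_factors d"
    hence "multiplicity p d > 0" by (simp add: prime_factors_multiplicity)
    moreover have "multiplicity p d \<le> 1"
      using assms p squarefree_factorial_semiring'[of d] d by auto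
    ultimately have "multiplicity p d = 1" by linarith
    thus "p ^ multiplicity p d = p" by simp
  qed
  finally show ?thesis ..
qed

text \<open>
  Divisors of a square-free number correspond to sets of its prime factors, so a sum of a
  multiplicative function over the divisors is the expansion of an Euler product.
\<close>
lemma sum_divisors_squarefree:
  fixes f g :: "nat \<Rightarrow> 'a :: comm_semiring_1"
  assumes "squarefree N" "\<And>S. S \<subseteq> prime_factors N \<Longrightarrow> f (\<Prod>S) = (\<Prod>p\<in>S. g p)"
  shows "(\<Sum>d | d dvd N. f d) = (\<Prod>p\<in>prime_factors N. g p + 1)"
proof -
  have N: "N > 0" using assms(1) by (auto intro!: Nat.gr0I)
  have bij: "bij_betw (\<lambda>S. \<Prod>S) (Pow (prime_factors N)) {d. d dvd N}"
  proof (rule bij_betwI[where g = prime_factors], goal_cases)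
    case 1
    have "\<Prod>S dvd N" if "S \<subseteq> prime_factors N" for S
      using prod_dvd_prod_subset[of "prime_factors N" S "\<lambda>x. x"] that 
      by (simp add: prod_prime_factors_squarefree[OF assms(1)])
    thus ?case by auto
  next
    case 2
    show ?case using N dvd_prime_factors[of N] by blast
  next
    case (3 S)
    thus ?case by (intro prime_factors_prod_primes) (auto intro: finite_subset)
  next
    case (4 d)
    hence "squarefree d" using assms(1) by (auto intro: squarefree_mono)
    thus ?case by (rule prod_prime_factors_squarefree)
  qed
  have "(\<Sum>d | d dvd N. f d) = (\<Sum>S\<in>Pow (prime_factors N). f (\<Prod>S))"
    by (rule sum.reindex_bij_betw[OF bij, symmetric])
  also have "\<dots> = (\<Sum>S\<in>Pow (prime_factors N). (\<Prod>p\<in>S. g p) * (\<Prod>p\<in>prime_factors N - S. 1))"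
    by (intro sum.cong refl) (use assms(2) in auto)
  also have "\<dots> = (\<Prod>p\<in>prime_factors N. g p + 1)"
    by (rule prod_add[symmetric]) simp
  finally show ?thesis .
qed

lemma gcd_mult_coprime_distrib:
  fixes c x y :: nat
  assumes "coprime x y"
  shows "gcd c (x * y) = gcd c x * gcd c y"
proof (rule dvd_antisym)
  have "coprime (gcd c x) (gcd c y)"
    using assms by (auto intro: coprime_divisors[of _ x _ y])
  thus "gcd c x * gcd c y dvd gcd c (x * y)"
    by (intro gcd_greatest divides_mult mult_dvd_mono) auto
next
  have "gcd c (x * y) dvd x * y" by simp
  then obtain g h where gh: "gcd c (x * y) = g * h" "g dvd x" "h dvd y"
    using division_decomp by blast
  have "g * h dvd c" using gh(1) by (metis gcd_dvd1)
  hence "g dvd c" "h dvd c" by (auto dest: dvd_mult_left dvd_mult_right)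
  thus "gcd c (x * y) dvd gcd c x * gcd c y"
    unfolding gh(1) using gh by (intro mult_dvd_mono gcd_greatest)
qed

lemma gcd_prod_primes:
  fixes c :: nat
  assumes "finite S" "\<And>p. p \<in> S \<Longrightarrow> prime p"
  shows "gcd c (\<Prod>S) = (\<Prod>p\<in>S. gcd c p)"
  using assms
proof (induction S rule: finite_induct)
  case (insert p S)
  have "coprime p (\<Prod>S)"
    using insert by (intro prod_coprime_right) (auto intro!: primes_coprime)
  thus ?case using insert by (simp add: gcd_mult_coprime_distrib)
qed auto

lemma divisor_gcd_matrix_column_sum:
  fixes c e N K :: nat
  assumes "squarefree N"
  shows "(\<Sum>d | d dvd N. (-1) ^ omega d * (of_nat (gcd c d * gcd e d) / of_nat d) ^ K) =
           (\<Prod>p\<in>prime_factors N. 1 - (of_nat (gcd c p * gcd e p) / of_nat p) ^ K :: complex)"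
proof -
  have "(\<Sum>d | d dvd N. (-1) ^ omega d * (of_nat (gcd c d * gcd e d) / of_nat d) ^ K) =
           (\<Prod>p\<in>prime_factors N. - ((of_nat (gcd c p * gcd e p) / of_nat p) ^ K) + (1::complex))"
  proof (rule sum_divisors_squarefree[OF assms])
    fix S assume S: "S \<subseteq> prime_factors N"
    hence fin: "finite S" and pr: "\<And>p. p \<in> S \<Longrightarrow> prime p" by (auto intro: finite_subset)
    have pf: "prime_factors (\<Prod>S) = S" using fin pr by (rule prime_factors_prod_primes)
    have g: "gcd x (\<Prod>S) = (\<Prod>p\<in>S. gcd x p)" for x using fin pr by (rule gcd_prod_primes)
    have "(-1) ^ omega (\<Prod>S) * (of_nat (gcd c (\<Prod>S) * gcd e (\<Prod>S)) / of_nat (\<Prod>S)) ^ K =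
            (\<Prod>p\<in>S. -1) * (\<Prod>p\<in>S. (of_nat (gcd c p * gcd e p) / of_nat p) ^ K :: complex)"
      unfolding omega_def pf g prod_power_distrib[symmetric] prod_dividef[symmetric]
      by (simp add: prod_dividef prod.distrib)
    also have "\<dots> = (\<Prod>p\<in>S. - ((of_nat (gcd c p * gcd e p) / of_nat p) ^ K))"
      unfolding prod.distrib[symmetric] by simp
    finally show "(-1) ^ omega (\<Prod>S) * (of_nat (gcd c (\<Prod>S) * gcd e (\<Prod>S)) / of_nat (\<Prod>S)) ^ K = \<dots>" .
  qed
  thus ?thesis by simp
qed

lemma gcd_prime_nat:
  fixes c p :: nat
  assumes "prime p"
  shows "gcd c p = (if p dvd c then p else 1)"
  using assms prime_imp_coprime[of p c] by (auto simp: gcd.commute gcd_proj1_iff coprime_iff_gcd_eq_1)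

text \<open>
  The entry \<open>(c, e)\<close> of a product of two matrices indexed by the divisors of \<open>N\<close>, one having
  the entries \<open>(gcd d e / d)\<^sup>K\<close> and the other being its inverse up to the factor on the right. In the Euler product
  of the column sum a prime that divides exactly one of \<open>c\<close> and \<open>e\<close> gives the factor \<open>1 - 1 = 0\<close>. If \<open>c = e\<close>,
  the primes dividing \<open>c\<close> give \<open>1 - p\<^sup>K\<close> and the others \<open>1 - p\<^bsup>-K\<^esup>\<close>; the prefactor repairs the signs and the
  denominators.
\<close>
lemma divisor_gcd_matrix_inverse:
  fixes c e N K :: nat
  assumes "squarefree N" "c dvd N" "e dvd N"
  shows "(-1) ^ omega c * (of_nat N / of_nat c) ^ K *
         (\<Sum>d | d dvd N. (-1) ^ omega d * (of_nat (gcd c d * gcd e d) / of_nat d) ^ K) =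
           (if c = e then \<Prod>p\<in>prime_factors N. of_nat p ^ K - 1 else 0 :: complex)"
proof -
  let ?t = "\<lambda>p. 1 - (of_nat (gcd c p * gcd e p) / of_nat p) ^ K :: complex"
  have sq: "squarefree c" "squarefree e" using assms by (auto intro: squarefree_mono)
  have N: "N > 0" using assms(1) by (auto intro!: Nat.gr0I)
  have sub: "prime_factors c \<subseteq> prime_factors N" "prime_factors e \<subseteq> prime_factors N" 
    using assms N dvd_prime_factors[of N] by blast+
  show ?thesis
  proof (cases "c = e")
    case False
    hence "prime_factors c \<noteq> prime_factors e"
      using prod_prime_factors_squarefree sq by metis
    then obtain p where p: "p \<in> prime_factors N" "p \<in> prime_factors c \<longleftrightarrow> p \<notin> prime_factors e"
      using sub by blast
    have "c > 0" "e > 0" using sq by (auto intro!: Nat.gr0I)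
    hence "p dvd c \<longleftrightarrow> \<not> p dvd e" using p by (auto simp: prime_factors_dvd)
    moreover have "prime p" using p(1) by auto
    hence "p > 0" by (rule prime_gt_0_nat)
    ultimately have "?t p = 0" using \<open>prime p\<close> by (auto simp: gcd_prime_nat)
    hence "(\<Prod>p\<in>prime_factors N. ?t p) = 0" using p(1) by (auto simp: prod_zero_iff)
    thus ?thesis using False unfolding divisor_gcd_matrix_column_sum[OF assms(1)] by simp
  next
    case True
    let ?P = "prime_factors N" and ?Q = "prime_factors c"
    have "of_nat N = (\<Prod>p\<in>?P. of_nat p :: complex)" "of_nat c = (\<Prod>p\<in>?Q. of_nat p :: complex)"
      unfolding of_nat_prod[symmetric] by (simp_all add: prod_prime_factors_squarefree assms sq)
    moreover have "(\<Prod>p\<in>?P. of_nat p :: complex) = (\<Prod>p\<in>?P - ?Q. of_nat p) * (\<Prod>p\<in>?Q. of_nat p)"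
      by (rule prod.subset_diff[OF sub(1)]) simp
    moreover have "(\<Prod>p\<in>?Q. of_nat p :: complex) \<noteq> 0" by (auto simp: prod_zero_iff)
    ultimately have Nc: "of_nat N / of_nat c = (\<Prod>p\<in>?P - ?Q. of_nat p :: complex)" by simp
    have neg: "(\<Prod>p\<in>?Q. -1) * (\<Prod>p\<in>?Q. ?t p) = (\<Prod>p\<in>?Q. - ?t p)"
      unfolding prod.distrib[symmetric] by simp
    have "(-1) ^ omega c * (of_nat N / of_nat c) ^ K * (\<Prod>p\<in>?P. ?t p) =
       (\<Prod>p\<in>?Q. -1) * (\<Prod>p\<in>?P - ?Q. of_nat p ^ K) * ((\<Prod>p\<in>?P - ?Q. ?t p) * (\<Prod>p\<in>?Q. ?t p))"
      using prod.subset_diff[OF sub(1), of ?t] by (simp add: omega_def Nc prod_power_distrib)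
    also have "\<dots> = (\<Prod>p\<in>?P - ?Q. of_nat p ^ K * ?t p) * (\<Prod>p\<in>?Q. - ?t p)"
      unfolding neg[symmetric] prod.distrib by (simp only: mult_ac)
    also have "(\<Prod>p\<in>?P - ?Q. of_nat p ^ K * ?t p) = (\<Prod>p\<in>?P - ?Q. of_nat p ^ K - 1)"
    proof (intro prod.cong refl)
      fix p assume p: "p \<in> ?P - ?Q"
      moreover have "c \<noteq> 0" using sq not_squarefree_0 by metis
      ultimately have "\<not> p dvd c" "prime p" by (auto simp: prime_factors_dvd)
      hence "gcd c p = 1" "p > 0" by (auto simp: gcd_prime_nat prime_gt_0_nat)
      thus "of_nat p ^ K * ?t p = of_nat p ^ K - 1"
        using True by (simp add: power_divide field_simps)
    qed
    also have "(\<Prod>p\<in>?Q. - ?t p) = (\<Prod>p\<in>?Q. of_nat p ^ K - 1)"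
    proof (intro prod.cong refl)
      fix p assume p: "p \<in> ?Q"
      hence "p dvd c" "prime p" by auto
      hence "gcd c p = p" "p > 0" by (auto simp: gcd_prime_nat prime_gt_0_nat)
      thus "- ?t p = of_nat p ^ K - 1" using True by simp
    qed
    also have "(\<Prod>p\<in>?P - ?Q. of_nat p ^ K - 1) * (\<Prod>p\<in>?Q. of_nat p ^ K - 1 :: complex) = 
               (\<Prod>p\<in>?P. of_nat p ^ K - 1)"
      by (rule prod.subset_diff[OF sub(1), symmetric]) simp
    finally show ?thesis using True unfolding divisor_gcd_matrix_column_sum[OF assms(1)] by simp
  qed
qed

text \<open>
  The combination of the series \<open>E\<^sub>K(d z)\<close> with prescribed constant terms \<open>y e\<close> at the cusps \<open>1 / e\<close> has the
  coefficients in parentheses, because \<open>(gcd d e / d)\<^sup>K\<close> is the constant term of \<open>E\<^sub>K(d z)\<close> there.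
\<close>
lemma divisor_gcd_linear_system:
  fixes y :: "nat \<Rightarrow> complex"
  assumes "squarefree N" "e dvd N" "K > 0"
  shows "(\<Sum>d | d dvd N. (\<Sum>c | c dvd N. (-1) ^ (omega d + omega c) / (\<Prod>p\<in>prime_factors N. of_nat p ^ K - 1) *
            (of_nat N * of_nat (gcd c d) / of_nat c) ^ K * y c) * (of_nat (gcd d e) / of_nat d) ^ K) = y e"
proof -
  let ?P = "\<Prod>p\<in>prime_factors N. of_nat p ^ K - 1 :: complex"
  have N: "N > 0" using assms(1) by (auto intro!: Nat.gr0I)
  have fin: "finite {d. d dvd N}" using N by simp
  have "of_nat p ^ K - 1 \<noteq> (0::complex)" if "p \<in> prime_factors N" for p
  proof
    assume "of_nat p ^ K - 1 = (0::complex)"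
    hence "p ^ K = 1" using of_nat_eq_iff[of "p ^ K" 1, where ?'a = complex] by simp
    moreover have "p > 1" using that by (intro prime_gt_1_nat) auto
    ultimately show False using assms(3) by (simp add: power_eq_1_iff)
  qed
  hence P: "?P \<noteq> 0" by (auto simp: prod_zero_iff)
  have "(\<Sum>d | d dvd N. (\<Sum>c | c dvd N. (-1) ^ (omega d + omega c) / ?P *
            (of_nat N * of_nat (gcd c d) / of_nat c) ^ K * y c) * (of_nat (gcd d e) / of_nat d) ^ K) =
        (\<Sum>d | d dvd N. \<Sum>c | c dvd N. y c / ?P * ((-1) ^ omega c * (of_nat N / of_nat c) ^ K *
            ((-1) ^ omega d * (of_nat (gcd c d * gcd e d) / of_nat d) ^ K)))"
    unfolding sum_distrib_right
    by (intro sum.cong refl) (simp add: power_add power_mult_distrib power_divide gcd.commute[of e] mult_ac)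
  also have "\<dots> = (\<Sum>c | c dvd N. \<Sum>d | d dvd N. y c / ?P * ((-1) ^ omega c * (of_nat N / of_nat c) ^ K *
            ((-1) ^ omega d * (of_nat (gcd c d * gcd e d) / of_nat d) ^ K)))"
    by (rule sum.swap)
  also have "\<dots> = (\<Sum>c | c dvd N. y c / ?P * (if c = e then ?P else 0))"
    unfolding sum_distrib_left[symmetric]
    by (intro sum.cong refl, subst divisor_gcd_matrix_inverse) (use assms in auto)
  also have "\<dots> = (\<Sum>c | c dvd N. if c = e then y c else 0)"
    by (intro sum.cong refl) (use P in auto)
  also have "\<dots> = y e" using assms fin by simp
  finally show ?thesis .
qed

section \<open>Fourier expansions\<close>

lemma nome_surj:
  assumes "q \<noteq> 0" "norm q < 1" "N > 0"
  obtains z where "Im z > 0" "exp (2 * of_real pi * \<i> * z / of_nat N) = q"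
proof
  let ?z = "of_nat N * Ln q / (2 * of_real pi * \<i>)"
  show "exp (2 * of_real pi * \<i> * ?z / of_nat N) = q"
    using assms by simp
  have "ln (norm q) < 0" using assms by simp
  hence "Re (Ln q) < 0" using assms by simp
  thus "Im ?z > 0" using assms by (simp add: Im_divide zero_less_mult_iff divide_less_0_iff mult_less_0_iff)
qed

lemma fourier_expansion_summable:
  assumes "has_fourier_expansion N f F" "N > 0" "norm q < 1"
  shows "summable (\<lambda>n. norm (F n * q ^ n))"
proof -
  obtain r where r: "norm q < r" "r < 1" using dense[OF assms(3)] by blast
  have r0: "r > 0" using r(1) norm_ge_zero[of q] by linarith
  obtain z where z: "Im z > 0" "exp (2 * of_real pi * \<i> * z / of_nat N) = complex_of_real r"
    using nome_surj[of "complex_of_real r" N] r r0 assms(2) by auto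
  have "summable (\<lambda>n. F n * of_real r ^ n)"
    using assms(1) z by (auto simp: has_fourier_expansion_def sums_iff)
  thus ?thesis by (rule powser_insidea) (use r r0 in simp)
qed

text \<open>
  On the upper half plane the nome only takes non-zero values, so the power series are compared on a punctured
  disc. Multiplying the difference by \<open>q\<close> makes it vanish at the origin too, after which the isolation of
  zeros applies.
\<close>
lemma fourier_expansion_unique:
  assumes "has_fourier_expansion N f F" "has_fourier_expansion N f G" "N > 0"
  shows "F = G"
proof (rule ccontr)
  assume "F \<noteq> G"
  then obtain m where m: "F m \<noteq> G m" by blast
  define H where "H = (\<lambda>n. F n - G n)"
  define a where "a = (\<lambda>n. case n of 0 \<Rightarrow> 0 | Suc n \<Rightarrow> H n)"
  have sm: "(\<lambda>n. a n * (q - 0) ^ n) sums 0" if "norm (q - 0) < 1" for q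
  proof (cases "q = 0")
    case True
    have "(\<lambda>n. a n * (q - 0) ^ n) = (\<lambda>_. 0)"
      using True by (auto simp: a_def fun_eq_iff power_0_left split: nat.splits)
    thus ?thesis by simp
  next
    case False
    have "norm q < 1" using that by simp
    then obtain z where z: "Im z > 0" "exp (2 * of_real pi * \<i> * z / of_nat N) = q"
      using nome_surj[OF False _ assms(3)] by blast
    hence "(\<lambda>n. F n * q ^ n) sums f z" "(\<lambda>n. G n * q ^ n) sums f z"
      using assms unfolding has_fourier_expansion_def by auto
    hence "(\<lambda>n. F n * q ^ n - G n * q ^ n) sums (f z - f z)" by (rule sums_diff)
    hence "(\<lambda>n. q * (H n * q ^ n)) sums (q * 0)"
      by (intro sums_mult) (simp add: H_def algebra_simps)
    hence "(\<lambda>n. a (Suc n) * (q - 0) ^ Suc n) sums 0" by (simp add: a_def mult_ac)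
    thus ?thesis by (subst (asm) sums_Suc_iff) (simp add: a_def)
  qed
  have nz: "a (Suc m) \<noteq> 0" using m by (simp add: a_def H_def)
  show False
  proof (rule powser_0_nonzero[where r = 1 and a = a and \<xi> = 0 and f = "\<lambda>_. 0" and m = "Suc m"])
    show "(\<lambda>n. a n * (q - 0) ^ n) sums 0" if "norm (q - 0) < 1" for q
      using sm[OF that] .
    show "a (Suc m) \<noteq> 0" by (rule nz)
    fix s :: real assume s: "0 < s" "\<And>z::complex. z \<in> cball 0 s - {0} \<Longrightarrow> (0::complex) \<noteq> 0"
    from s(2)[of "of_real s"] s(1) show False by simp
  qed auto
qed

lemma fourier_coeff_eqI:
  assumes "has_fourier_expansion 1 f F"
  shows "fourier_coeff n f = F n"
proof -
  have "(THE c. has_fourier_expansion 1 f c) = F"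
    using assms fourier_expansion_unique[of 1 f] by (intro the_equality) auto
  thus ?thesis by (simp add: fourier_coeff_def)
qed

lemma fourier_expansion_holomorphic:
  assumes "has_fourier_expansion N f F" "N > 0"
  shows "f holomorphic_on upper_half_plane"
proof -
  have hol: "(\<lambda>q. \<Sum>n. F n * q ^ n) holomorphic_on ball 0 1"
  proof (rule power_series_holomorphic)
    fix q :: complex assume "q \<in> ball 0 1"
    hence "summable (\<lambda>n. F n * q ^ n)"
      using fourier_expansion_summable[OF assms] by (auto intro: summable_norm_cancel)
    thus "(\<lambda>n. F n * (q - 0) ^ n) sums (\<Sum>n. F n * q ^ n)" by (simp add: summable_sums)
  qed
  let ?g = "\<lambda>z. exp (2 * of_real pi * \<i> * z / of_nat N)"
  have "?g ` upper_half_plane \<subseteq> ball 0 1"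
    using norm_nome_less_1[of _ "real N"] assms(2) by auto
  moreover have "?g holomorphic_on upper_half_plane"
    using assms(2) by (intro holomorphic_intros) auto
  ultimately have "((\<lambda>q. \<Sum>n. F n * q ^ n) \<circ> ?g) holomorphic_on upper_half_plane"
    using hol by (intro holomorphic_on_compose_gen[of ?g _ _ "ball 0 1"])
  moreover have "((\<lambda>q. \<Sum>n. F n * q ^ n) \<circ> ?g) z = f z" if "z \<in> upper_half_plane" for z
    using assms(1) that by (auto simp: has_fourier_expansion_def sums_iff)
  ultimately show ?thesis by (rule holomorphic_transform)
qed

lemma has_fourier_expansion_cong:
  assumes "\<And>z. Im z > 0 \<Longrightarrow> f z = g z"
  shows "has_fourier_expansion N f F \<longleftrightarrow> has_fourier_expansion N g F"
  using assms by (simp add: has_fourier_expansion_def)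

lemma has_fourier_expansion_mult:
  assumes "has_fourier_expansion N f F" "has_fourier_expansion N g G" "N > 0"
  shows "has_fourier_expansion N (\<lambda>z. f z * g z) (\<lambda>n. \<Sum>i\<le>n. F i * G (n - i))"
  unfolding has_fourier_expansion_def
proof
  fix z :: complex assume z: "z \<in> upper_half_plane"
  define q where "q = exp (2 * of_real pi * \<i> * z / of_nat N)"
  have q: "norm q < 1" using norm_nome_less_1[of z "real N"] z assms(3) by (simp add: q_def)
  have "(\<lambda>n. F n * q ^ n) sums f z" "(\<lambda>n. G n * q ^ n) sums g z"
    using assms z unfolding has_fourier_expansion_def q_def by auto
  moreover have "(\<lambda>n. \<Sum>i\<le>n. F i * q ^ i * (G (n - i) * q ^ (n - i))) sums 
                   ((\<Sum>n. F n * q ^ n) * (\<Sum>n. G n * q ^ n))"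
    using assms q by (intro Cauchy_product_sums fourier_expansion_summable) auto
  moreover have "(\<Sum>i\<le>n. F i * q ^ i * (G (n - i) * q ^ (n - i))) = (\<Sum>i\<le>n. F i * G (n - i)) * q ^ n" for n
    unfolding sum_distrib_right
  proof (intro sum.cong refl)
    fix i assume "i \<in> {..n}"
    hence "q ^ n = q ^ i * q ^ (n - i)" by (simp add: power_add[symmetric])
    thus "F i * q ^ i * (G (n - i) * q ^ (n - i)) = F i * G (n - i) * q ^ n" by simp
  qed
  ultimately show "(\<lambda>n. (\<Sum>i\<le>n. F i * G (n - i)) * q ^ n) sums (f z * g z)"
    by (simp add: sums_iff)
qed

lemma has_fourier_expansion_diff:
  assumes "has_fourier_expansion N f F" "has_fourier_expansion N g G"
  shows "has_fourier_expansion N (\<lambda>z. f z - g z) (\<lambda>n. F n - G n)"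
  using assms by (auto simp: has_fourier_expansion_def ring_distribs intro!: sums_diff)

lemma has_fourier_expansion_lincomb:
  assumes "\<And>d. d \<in> D \<Longrightarrow> has_fourier_expansion N (h d) (H d)"
  shows "has_fourier_expansion N (\<lambda>z. \<Sum>d\<in>D. x d * h d z) (\<lambda>n. \<Sum>d\<in>D. x d * H d n)"
  unfolding has_fourier_expansion_def
proof
  fix z :: complex assume z: "z \<in> upper_half_plane"
  let ?q = "exp (2 * of_real pi * \<i> * z / of_nat N)"
  have "(\<lambda>n. \<Sum>d\<in>D. x d * (H d n * ?q ^ n)) sums (\<Sum>d\<in>D. x d * h d z)"
    using assms z by (intro sums_sum sums_mult) (simp add: has_fourier_expansion_def)
  thus "(\<lambda>n. (\<Sum>d\<in>D. x d * H d n) * ?q ^ n) sums (\<Sum>d\<in>D. x d * h d z)"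
    by (simp add: sum_distrib_right mult.assoc)
qed

section \<open>Eisenstein series at the cusps\<close>

definition eisenstein_coeff :: "nat \<Rightarrow> nat \<Rightarrow> complex" where
  "eisenstein_coeff w n = 
     (if n = 0 then 1 else - (2 * of_nat w / of_real (bernoulli w)) * of_nat (divisor_sigma (w - 1) (of_nat n)))"

lemma eisenstein_sums:
  assumes "Im z > 0"
  shows "(\<lambda>n. eisenstein_coeff w n * exp (2 * of_real pi * \<i> * z) ^ n) sums eisenstein w z"
proof -
  let ?q = "exp (2 * of_real pi * \<i> * z)"
  let ?c = "2 * of_nat w / of_real (bernoulli w) :: complex"
  have "summable (\<lambda>n. of_nat (divisor_sigma (w - 1) (of_nat (Suc n))) * ?q ^ Suc n)"
    using summable_norm_divisor_sigma[OF norm_nome_width_1_less_1[OF assms]] by (rule summable_norm_cancel)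
  hence "(\<lambda>n. - ?c * (of_nat (divisor_sigma (w - 1) (of_nat (Suc n))) * ?q ^ Suc n)) sums
           (- ?c * (\<Sum>n. of_nat (divisor_sigma (w - 1) (of_nat (Suc n))) * ?q ^ Suc n))"
    by (intro sums_mult summable_sums)
  hence "(\<lambda>n. eisenstein_coeff w (Suc n) * ?q ^ Suc n) sums (eisenstein w z - 1)"
    by (simp add: eisenstein_coeff_def eisenstein_def mult.assoc del: of_nat_Suc)
  thus ?thesis by (subst (asm) sums_Suc_iff) (simp add: eisenstein_coeff_def)
qed

text \<open>
  With \<open>N = \<delta> M\<close>, the nome at \<open>(\<alpha> z + \<beta>) / \<delta>\<close> is a root of unity times the power \<open>\<alpha> M\<close> of the nome
  of width \<open>N\<close>.
\<close>
lemma eisenstein_affine_fourier: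
  fixes \<alpha> \<delta> M N w :: nat and \<beta> :: int
  assumes "\<alpha> > 0" "\<delta> > 0" "M > 0" "N = \<delta> * M"
  shows "has_fourier_expansion N (\<lambda>z. eisenstein w ((of_nat \<alpha> * z + of_int \<beta>) / of_nat \<delta>))
           (\<lambda>n. if \<alpha> * M dvd n then eisenstein_coeff w (n div (\<alpha> * M)) *
                   exp (2 * of_real pi * \<i> * of_int \<beta> / of_nat \<delta>) ^ (n div (\<alpha> * M)) else 0)"
  unfolding has_fourier_expansion_def
proof
  fix z :: complex assume "z \<in> upper_half_plane"
  hence z: "Im z > 0" by simp
  let ?w = "(of_nat \<alpha> * z + of_int \<beta>) / of_nat \<delta>"
  let ?q = "exp (2 * of_real pi * \<i> * z / of_nat N)"
  let ?\<zeta> = "exp (2 * of_real pi * \<i> * of_int \<beta> / of_nat \<delta>)"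
  let ?r = "\<alpha> * M"
  let ?f = "\<lambda>n. (if ?r dvd n then eisenstein_coeff w (n div ?r) * ?\<zeta> ^ (n div ?r) else 0) * ?q ^ n"
  have r: "?r > 0" using assms by simp
  have "Im ?w > 0" using z assms by simp
  hence "(\<lambda>n. eisenstein_coeff w n * exp (2 * of_real pi * \<i> * ?w) ^ n) sums eisenstein w ?w"
    by (rule eisenstein_sums)
  also have "exp (2 * of_real pi * \<i> * ?w) = ?\<zeta> * ?q ^ ?r"
    unfolding exp_of_nat_mult[symmetric] exp_add[symmetric] using assms
    by (intro arg_cong[of _ _ exp]) (simp add: field_simps)
  also have "(\<lambda>n. eisenstein_coeff w n * (?\<zeta> * ?q ^ ?r) ^ n) = (\<lambda>n. ?f (?r * n))"
    using r by (simp add: power_mult power_mult_distrib mult.assoc)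
  also have "\<dots> sums eisenstein w ?w \<longleftrightarrow> ?f sums eisenstein w ?w"
    by (rule sums_mono_reindex) (use r in \<open>auto intro: strict_monoI\<close>)
  finally show "?f sums eisenstein w ?w" .
qed

lemma slash_lincomb:
  assumes "u + v = k"
  shows "slash k A (\<lambda>z. f z * g z - (\<Sum>d\<in>D. x d * h d z)) z =
           slash u A f z * slash v A g z - (\<Sum>d\<in>D. x d * slash k A (h d) z)"
  by (simp add: slash_def assms[symmetric] power_add diff_divide_distrib sum_divide_distrib)

text \<open>
  The lower left entry of \<open>A\<close> is divisible by \<open>t\<close>. Hence \<open>t (A z) = A' (t z)\<close>, where \<open>A'\<close> arises from \<open>A\<close> by dividing that
  entry by \<open>t\<close> and multiplying the upper right one by \<open>t\<close>, which leaves the determinant and the factor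
  of automorphy unchanged.
\<close>
lemma eisenstein_dilate_slash_Gamma0:
  assumes "A \<in> Gamma0 N" "t dvd N" "t > 0" "even w" "w \<ge> 4" "Im z > 0"
  shows "slash w A (\<lambda>z. eisenstein w (of_nat t * z)) z = eisenstein w (of_nat t * z)"
proof -
  define a b c d where abcd: "a = A $ 1 $ 1" "b = A $ 1 $ 2" "c = A $ 2 $ 1" "d = A $ 2 $ 2"
  have det: "a * d - b * c = 1" and "int N dvd c"
    using assms(1) by (auto simp: Gamma0_def det_2 abcd)
  hence "int t dvd c" using assms(2) by (meson dvd_trans int_dvd_int_iff)
  then obtain e where e: "c = int t * e" by blast
  have det': "a * d - (int t * b) * e = 1" using det by (simp add: e mult_ac)
  let ?j = "of_int c * z + of_int d"
  have j: "?j \<noteq> 0" using moebius_Im(1)[OF det assms(6)] .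
  have "of_nat t * ((of_int a * z + of_int b) / ?j) = 
     (of_int a * (of_nat t * z) + of_int (int t * b)) / (of_int e * (of_nat t * z) + of_int d)"
    by (simp add: e ring_distribs mult_ac)
  moreover have "Im (of_nat t * z) > 0" using assms by simp
  from eisenstein_modular[OF det' this assms(4,5)] 
  have "eisenstein w ((of_int a * (of_nat t * z) + of_int (int t * b)) / (of_int e * (of_nat t * z) + of_int d)) =
     ?j ^ w * eisenstein w (of_nat t * z)" by (simp add: e mult_ac)
  ultimately show ?thesis using j by (simp add: slash_def flip: abcd)
qed

text \<open>
  The matrix \<open>diag(t, 1) A\<close> has determinant \<open>t\<close> and hence factors as \<open>A' U\<close>, where \<open>A'\<close> is in the full modular
  group and \<open>U\<close> is upper triangular with rows \<open>(\<alpha>, \<beta>)\<close> and \<open>(0, \<delta>)\<close>. Modularity removes \<open>A'\<close>. Comparing the first columns,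
  \<open>\<alpha>\<close> is the greatest common divisor of the first column of \<open>diag(t, 1) A\<close>, which is \<open>gcd t c\<close> because
  the first column of \<open>A\<close> is coprime.
\<close>
lemma eisenstein_dilate_slash_SL2:
  fixes A :: "int ^ 2 ^ 2"
  assumes "A \<in> Gamma0 1" "t > 0" "even w" "w \<ge> 4"
  obtains \<alpha> \<delta> :: nat and \<beta> :: int 
  where "\<alpha> * \<delta> = t" "\<alpha> = gcd t (nat \<bar>A $ 2 $ 1\<bar>)"
    "\<And>z. Im z > 0 \<Longrightarrow> slash w A (\<lambda>z. eisenstein w (of_nat t * z)) z = 
              eisenstein w ((of_nat \<alpha> * z + of_int \<beta>) / of_nat \<delta>) / of_nat \<delta> ^ w"
proof -
  define a b c d where abcd: "a = A $ 1 $ 1" "b = A $ 1 $ 2" "c = A $ 2 $ 1" "d = A $ 2 $ 2"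
  have det: "a * d - b * c = 1"
    using assms(1) by (auto simp: Gamma0_def det_2 abcd)
  define \<alpha> where "\<alpha> = gcd t (nat \<bar>c\<bar>)"
  have \<alpha>: "\<alpha> > 0" using assms(2) by (simp add: \<alpha>_def)
  have "\<alpha> dvd t" unfolding \<alpha>_def by (rule gcd_dvd1)
  then obtain \<delta> where \<delta>: "t = \<alpha> * \<delta>" by (elim dvdE)
  have \<delta>0: "\<delta> > 0" using \<delta> assms(2) by (auto intro!: Nat.gr0I)
  have "int \<alpha> dvd c" unfolding \<alpha>_def by simp
  then obtain c' where c': "c = int \<alpha> * c'" by blast
  define a' where "a' = int \<delta> * a"
  have "int \<alpha> = gcd (int t) (int (nat \<bar>c\<bar>))"
    unfolding \<alpha>_def by (rule gcd_int_int_eq[symmetric])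
  also have "\<dots> = gcd (int \<alpha> * int \<delta>) (int \<alpha> * c')"
    unfolding of_nat_mult[symmetric] \<delta>[symmetric] c'[symmetric] by simp
  also have "\<dots> = \<bar>int \<alpha>\<bar> * gcd (int \<delta>) c'"
    by (rule gcd_mult_distrib_int[symmetric])
  finally have "gcd (int \<delta>) c' = 1" using \<alpha> by simp
  hence "coprime (int \<delta>) c'" by (rule iffD2[OF coprime_iff_gcd_eq_1])
  moreover have "coprime a c'"
  proof (rule coprimeI)
    fix x assume "x dvd a" "x dvd c'"
    hence "x dvd a * d - b * c" unfolding c' by simp
    thus "is_unit x" by (simp add: det)
  qed
  ultimately have "coprime a' c'" by (simp add: a'_def)
  then obtain d' b0 where "d' * a' + b0 * c' = 1"
    using bezout_int[of a' c'] unfolding coprime_iff_gcd_eq_1 by metis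
  hence "\<exists>b'. a' * d' - b' * c' = 1" by (intro exI[of _ "- b0"]) (simp add: algebra_simps)
  then obtain b' where det': "a' * d' - b' * c' = 1" by blast
  \<comment> \<open>\<open>A'\<close> has the rows \<open>(a', b')\<close> and \<open>(c', d')\<close>; \<open>\<beta>\<close> is the upper right entry of \<open>inverse(A') diag(t, 1) A\<close>\<close>
  define \<beta> where "\<beta> = d' * (int t * b) - b' * d"
  have E1: "a' * int \<alpha> = int t * a" by (simp add: a'_def \<delta>)
  have D: "int \<delta> = a' * d - c' * (int t * b)"
  proof -
    have "a' * d - c' * (int t * b) = int \<delta> * (a * d - b * c)"
      by (simp add: a'_def c' \<delta> algebra_simps)
    thus ?thesis by (simp add: det)
  qed
  have "a' * \<beta> + b' * int \<delta> = (a' * d' - b' * c') * (int t * b)" unfolding D \<beta>_def by algebra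
  hence E2: "a' * \<beta> + b' * int \<delta> = int t * b" by (simp add: det')
  have "c' * \<beta> + d' * int \<delta> = (a' * d' - b' * c') * d" unfolding D \<beta>_def by algebra
  hence E3: "c' * \<beta> + d' * int \<delta> = d" by (simp add: det')
  show ?thesis
  proof (rule that[of \<alpha> \<delta> \<beta>])
    show "\<alpha> * \<delta> = t" by (rule \<delta>[symmetric])
    show "\<alpha> = gcd t (nat \<bar>A $ 2 $ 1\<bar>)" unfolding \<alpha>_def abcd ..
    fix z :: complex assume z: "Im z > 0"
    let ?w = "(of_nat \<alpha> * z + of_int \<beta>) / of_nat \<delta>"
    let ?j = "of_int c * z + of_int d"
    have w: "Im ?w > 0" using z \<alpha> \<delta>0 by simp
    have j: "?j \<noteq> 0" using moebius_Im(1)[OF det z] .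
    have num: "of_int a' * ?w + of_int b' = of_nat t * (of_int a * z + of_int b) / of_nat \<delta>"
    proof -
      have "of_int a' * ?w + of_int b' = (of_int (a' * int \<alpha>) * z + of_int (a' * \<beta> + b' * int \<delta>)) / of_nat \<delta>"
        using \<delta>0 by (simp add: field_simps)
      thus ?thesis unfolding E1 E2 by (simp add: field_simps)
    qed
    have den: "of_int c' * ?w + of_int d' = ?j / of_nat \<delta>"
    proof -
      have "of_int c' * ?w + of_int d' = (of_int (int \<alpha> * c') * z + of_int (c' * \<beta> + d' * int \<delta>)) / of_nat \<delta>"
        using \<delta>0 by (simp add: field_simps)
      thus ?thesis unfolding E3 c'[symmetric] .
    qed
    have "of_nat t * ((of_int a * z + of_int b) / ?j) = (of_int a' * ?w + of_int b') / (of_int c' * ?w + of_int d')"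
      unfolding num den using \<delta>0 by simp
    hence "eisenstein w (of_nat t * ((of_int a * z + of_int b) / ?j)) = (of_int c' * ?w + of_int d') ^ w * eisenstein w ?w"
      by (simp only: eisenstein_modular[OF det' w assms(3,4)])
    hence "eisenstein w (of_nat t * ((of_int a * z + of_int b) / ?j)) = (?j / of_nat \<delta>) ^ w * eisenstein w ?w"
      unfolding den .
    thus "slash w A (\<lambda>z. eisenstein w (of_nat t * z)) z = eisenstein w ?w / of_nat \<delta> ^ w"
      using j by (simp add: slash_def power_divide flip: abcd)
  qed
qed

text \<open>
  The constant term only depends on the cusp through the greatest common divisor of \<open>N\<close> with the lower left
  entry of \<open>A\<close>; a common value \<open>e\<close> for all \<open>t\<close> is what makes the conditions at the cusps a linear system
  indexed by the divisors of \<open>N\<close>.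
\<close>
lemma eisenstein_dilate_cusp_expansion:
  fixes A :: "int ^ 2 ^ 2"
  assumes "A \<in> Gamma0 1" "N > 0" "t dvd N" "even w" "w \<ge> 4"
  shows "\<exists>F. has_fourier_expansion N (slash w A (\<lambda>z. eisenstein w (of_nat t * z))) F \<and>
             F 0 = (of_nat (gcd t (gcd N (nat \<bar>A $ 2 $ 1\<bar>))) / of_nat t) ^ w"
proof -
  have t: "t > 0" using assms by (auto intro!: Nat.gr0I)
  obtain \<alpha> \<delta> :: nat and \<beta> :: int 
  where *: "\<alpha> * \<delta> = t" "\<alpha> = gcd t (nat \<bar>A $ 2 $ 1\<bar>)"
    "\<And>z. Im z > 0 \<Longrightarrow> slash w A (\<lambda>z. eisenstein w (of_nat t * z)) z = 
              eisenstein w ((of_nat \<alpha> * z + of_int \<beta>) / of_nat \<delta>) / of_nat \<delta> ^ w"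
    using eisenstein_dilate_slash_SL2[OF assms(1) t assms(4,5)] by blast
  have pos: "\<alpha> > 0" "\<delta> > 0" using *(1) t by (auto intro!: Nat.gr0I)
  obtain M where M: "N = \<delta> * M" using *(1) assms(3) by (metis dvdE dvd_mult_right mult.commute)
  have M0: "M > 0" using M assms(2) by (auto intro!: Nat.gr0I)
  let ?F = "\<lambda>n. if \<alpha> * M dvd n then eisenstein_coeff w (n div (\<alpha> * M)) *
                   exp (2 * of_real pi * \<i> * of_int \<beta> / of_nat \<delta>) ^ (n div (\<alpha> * M)) else 0"
  have "has_fourier_expansion N (\<lambda>z. \<Sum>x\<in>{()}. (1 / of_nat \<delta> ^ w) * 
           eisenstein w ((of_nat \<alpha> * z + of_int \<beta>) / of_nat \<delta>)) (\<lambda>n. \<Sum>x\<in>{()}. (1 / of_nat \<delta> ^ w) * ?F n)"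
    by (intro has_fourier_expansion_lincomb eisenstein_affine_fourier pos M0 M)
  also have "?this \<longleftrightarrow> has_fourier_expansion N (slash w A (\<lambda>z. eisenstein w (of_nat t * z))) (\<lambda>n. \<Sum>x\<in>{()}. (1 / of_nat \<delta> ^ w) * ?F n)"
    by (rule has_fourier_expansion_cong) (simp add: *(3))
  finally have "has_fourier_expansion N (slash w A (\<lambda>z. eisenstein w (of_nat t * z))) (\<lambda>n. (1 / of_nat \<delta> ^ w) * ?F n)"
    by simp
  moreover have "gcd t (gcd N (nat \<bar>A $ 2 $ 1\<bar>)) = \<alpha>"
    using assms(3) unfolding *(2) by (metis gcd.assoc gcd_nat.absorb1)
  hence "(of_nat (gcd t (gcd N (nat \<bar>A $ 2 $ 1\<bar>))) / of_nat t) ^ w = (1 / of_nat \<delta> ^ w :: complex)"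
    using pos by (simp add: *(1)[symmetric] power_divide power_mult_distrib)
  ultimately show ?thesis by (intro exI[of _ "\<lambda>n. (1 / of_nat \<delta> ^ w) * ?F n"]) (simp add: eisenstein_coeff_def)
qed

section \<open>The convolution sum\<close>

lemma divisor_sigma_quotient:
  assumes "n > 0" "t > 0"
  shows "divisor_sigma j (of_nat n / of_nat t) = 
          (if t dvd n then divisor_sigma j (of_nat (n div t)) else 0)"
proof (cases "t dvd n")
  case True
  thus ?thesis using assms by (auto elim!: dvdE)
next
  case False
  have "of_nat n / of_nat t \<notin> (\<nat> :: rat set)"
  proof
    assume "of_nat n / of_nat t \<in> (\<nat> :: rat set)"
    then obtain m where "of_nat n / of_nat t = (of_nat m :: rat)" by (elim Nats_cases)
    hence "of_nat n = (of_nat (m * t) :: rat)" using assms by (simp add: field_simps)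
    hence "n = m * t" by (simp only: of_nat_eq_iff)
    with False show False by simp
  qed
  thus ?thesis using False by (simp add: divisor_sigma_def)
qed

lemma eisenstein_dilate_fourier:
  assumes "t > 0"
  shows "has_fourier_expansion 1 (\<lambda>z. eisenstein w (of_nat t * z))
            (\<lambda>n. if n = 0 then 1 else - (2 * of_nat w / of_real (bernoulli w)) * 
                    of_nat (divisor_sigma (w - 1) (of_nat n / of_nat t)))"
proof -
  have "(\<lambda>n. if n = 0 then 1 else - (2 * of_nat w / of_real (bernoulli w)) * 
                    of_nat (divisor_sigma (w - 1) (of_nat n / of_nat t))) =
         (\<lambda>n. if t * 1 dvd n then eisenstein_coeff w (n div (t * 1)) *
                   exp (2 * of_real pi * \<i> * of_int 0 / of_nat 1) ^ (n div (t * 1)) else 0)"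
    using assms by (auto simp: fun_eq_iff eisenstein_coeff_def divisor_sigma_quotient elim!: dvdE)
  thus ?thesis using eisenstein_affine_fourier[of t 1 1 1 w 0] assms by simp
qed

text \<open>
  The substitution \<open>i = a r\<close>, \<open>n - i = b s\<close>; the other values of \<open>i\<close> contribute nothing, because \<open>\<sigma>\<close> vanishes at
  non-integers. In this form the convolution sum is the inner part of a Cauchy product.
\<close>
lemma convolution_sum_eq:
  assumes "a > 0" "b > 0"
  shows "(\<Sum>i\<in>{0<..<n}. divisor_sigma u (of_nat i / of_nat a) * divisor_sigma v (of_nat (n - i) / of_nat b))
           = convolution_sum a u b v n"
proof -
  let ?T = "{i \<in> {0<..<n}. a dvd i \<and> b dvd n - i}"
  have "(\<Sum>i\<in>{0<..<n}. divisor_sigma u (of_nat i / of_nat a) * divisor_sigma v (of_nat (n - i) / of_nat b)) =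
        (\<Sum>i\<in>?T. divisor_sigma u (of_nat i / of_nat a) * divisor_sigma v (of_nat (n - i) / of_nat b))"
    using assms by (intro sum.mono_neutral_right) (auto simp: divisor_sigma_quotient simp del: of_nat_diff)
  also have "\<dots> = (\<Sum>i\<in>?T. divisor_sigma u (of_nat (i div a)) * divisor_sigma v (of_nat ((n - i) div b)))"
    using assms by (intro sum.cong refl) (simp add: divisor_sigma_quotient del: of_nat_diff)
  also have "\<dots> = convolution_sum a u b v n"
    unfolding convolution_sum_def
    by (rule sum.reindex_bij_witness[where i = "\<lambda>(r, s). a * r" and j = "\<lambda>i. (i div a, (n - i) div b)"])
       (use assms in \<open>auto elim!: dvdE intro!: Nat.gr0I\<close>)
  finally show ?thesis .
qed

lemma convolution_sum_from_cusp_coefficient: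
  fixes b1 b2 b3 L M K W S sA sB fc :: complex
  assumes "b1 \<noteq> 0" "b2 \<noteq> 0" "L \<noteq> 0" "M \<noteq> 0"
    and "fc = (- (4 * M / b2) * sB - 4 * L / b1 * sA + (4 * L / b1) * (4 * M / b2) * W) - (- (4 * K / b3) * S)"
  shows "W = - K * b1 * b2 / (4 * L * M * b3) * S + b1 / (4 * L) * sB + b2 / (4 * M) * sA
            + b1 * b2 / (16 * L * M) * fc"
proof -
  define u where "u = 1 / b3"
  have "- K * b1 * b2 / (4 * L * M * b3) * S = - K * b1 * b2 / (4 * L * M) * u * S"
       "- (4 * K / b3) * S = - (4 * K * u) * S" by (simp_all add: u_def)
  thus ?thesis unfolding assms(5) using assms(1-4) by (simp add: field_simps)
qed

theorem theorem4p1: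
  fixes N l m k a b :: nat
  assumes "N > 0" and "squarefree N"
    and "l > 1" and "m > 1"
    and "a > 0" and "b > 0" and "lcm a b dvd N"
    and "k = l + m"
  shows "\<exists>C \<in> cusp_forms (2 * k) N.
    (\<forall>z \<in> upper_half_plane.
       eisenstein (2 * l) (of_nat a * z) * eisenstein (2 * m) (of_nat b * z) =
         (\<Sum>d | d dvd N.
            (\<Sum>c | c dvd N.
               (-1) ^ (omega d + omega c) / (\<Prod>p\<in>prime_factors N. of_nat p ^ (2 * k) - 1) *
               (of_nat N * of_nat (gcd c d) / of_nat c) ^ (2 * k) *
               (of_nat (gcd a c) / of_nat a) ^ (2 * l) *
               (of_nat (gcd b c) / of_nat b) ^ (2 * m)) *
            eisenstein (2 * k) (of_nat d * z))
         + C z) \<and>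
    (\<forall>n::nat. n > 0 \<longrightarrow>
       of_nat (convolution_sum a (2 * l - 1) b (2 * m - 1) n) =
         - of_nat k * of_real (bernoulli (2 * l)) * of_real (bernoulli (2 * m)) /
           (4 * of_nat l * of_nat m * of_real (bernoulli (2 * k))) *
         (\<Sum>d | d dvd N.
            (\<Sum>c | c dvd N.
               (-1) ^ (omega d + omega c) / (\<Prod>p\<in>prime_factors N. of_nat p ^ (2 * k) - 1) *
               (of_nat N * of_nat (gcd c d) / of_nat c) ^ (2 * k) *
               (of_nat (gcd a c) / of_nat a) ^ (2 * l) *
               (of_nat (gcd b c) / of_nat b) ^ (2 * m)) *
            of_nat (divisor_sigma (2 * k - 1) (of_nat n / of_nat d)))
         + of_real (bernoulli (2 * l)) / (4 * of_nat l) *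
             of_nat (divisor_sigma (2 * m - 1) (of_nat n / of_nat b))
         + of_real (bernoulli (2 * m)) / (4 * of_nat m) *
             of_nat (divisor_sigma (2 * l - 1) (of_nat n / of_nat a))
         + of_real (bernoulli (2 * l)) * of_real (bernoulli (2 * m)) /
             (16 * of_nat l * of_nat m) * fourier_coeff n C)"
proof -
  define x :: "nat \<Rightarrow> complex" where "x = (\<lambda>d. (\<Sum>c | c dvd N.
               (-1) ^ (omega d + omega c) / (\<Prod>p\<in>prime_factors N. of_nat p ^ (2 * k) - 1) *
               (of_nat N * of_nat (gcd c d) / of_nat c) ^ (2 * k) *
               (of_nat (gcd a c) / of_nat a) ^ (2 * l) *
               (of_nat (gcd b c) / of_nat b) ^ (2 * m)))"
  let ?E = "\<lambda>w t z. eisenstein w (of_nat t * z)"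
  let ?D = "{d. d dvd N}"
  define C where "C = (\<lambda>z. ?E (2 * l) a z * ?E (2 * m) b z - (\<Sum>d\<in>?D. x d * ?E (2 * k) d z))"
  have ab: "a dvd N" "b dvd N" using assms(7) by (auto intro: dvd_trans[OF dvd_lcm1] dvd_trans[OF dvd_lcm2])
  have d0: "d > 0" if "d \<in> ?D" for d using that assms(1) by (auto intro!: Nat.gr0I)
  have w: "2 * l \<ge> 4" "2 * m \<ge> 4" "2 * k \<ge> 4" "2 * l + 2 * m = 2 * k" using assms by auto
  have slash_C: "slash (2 * k) A C z = slash (2 * l) A (?E (2 * l) a) z * slash (2 * m) A (?E (2 * m) b) z -
                   (\<Sum>d\<in>?D. x d * slash (2 * k) A (?E (2 * k) d) z)" for A z
    unfolding C_def by (rule slash_lincomb) (rule w)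
  have system: "(\<Sum>d\<in>?D. x d * (of_nat (gcd d e) / of_nat d) ^ (2 * k)) =
                  (of_nat (gcd a e) / of_nat a) ^ (2 * l) * (of_nat (gcd b e) / of_nat b) ^ (2 * m)"
    if "e dvd N" for e
    using divisor_gcd_linear_system[OF assms(2) that, of "2 * k" 
      "\<lambda>c. (of_nat (gcd a c) / of_nat a) ^ (2 * l) * (of_nat (gcd b c) / of_nat b) ^ (2 * m)"] assms(3,8)
    by (simp add: x_def mult.assoc)

  define F where "F = (\<lambda>w t n. if n = 0 then 1 else - (2 * of_nat w / of_real (bernoulli w)) * 
                    of_nat (divisor_sigma (w - 1) (of_nat n / of_nat t)) :: complex)"
  have F: "has_fourier_expansion 1 (?E w t) (F w t)" if "t > 0" for w t
    unfolding F_def using that by (rule eisenstein_dilate_fourier)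
  have CF: "has_fourier_expansion 1 C 
         (\<lambda>n. (\<Sum>i\<le>n. F (2 * l) a i * F (2 * m) b (n - i)) - (\<Sum>d\<in>?D. x d * F (2 * k) d n))"
    unfolding C_def using assms(5,6) d0
    by (intro has_fourier_expansion_diff has_fourier_expansion_mult has_fourier_expansion_lincomb F) auto

  \<comment> \<open>the linear system is precisely the vanishing of the constant terms at the cusps\<close>
  have "C \<in> cusp_forms (2 * k) N"
    unfolding cusp_forms_def
  proof (intro CollectI conjI ballI)
    show "C holomorphic_on upper_half_plane"
      using CF by (rule fourier_expansion_holomorphic) simp
  next
    fix A z assume A: "A \<in> Gamma0 N" and z: "z \<in> upper_half_plane"
    have "slash w A (?E w t) z = ?E w t z" if "t dvd N" "even w" "w \<ge> 4" for w t
      using eisenstein_dilate_slash_Gamma0[OF A that(1) d0[simplified, OF that(1)] that(2,3)] z by simp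
    thus "slash (2 * k) A C z = C z" unfolding slash_C using ab w by (simp add: C_def)
  next
    fix A assume A: "A \<in> Gamma0 1"
    define e where "e = gcd N (nat \<bar>A $ 2 $ 1\<bar>)"
    have e: "e dvd N" unfolding e_def by (rule gcd_dvd1)
    have "\<forall>w t. t dvd N \<and> even w \<and> w \<ge> 4 \<longrightarrow> 
       (\<exists>G. has_fourier_expansion N (slash w A (?E w t)) G \<and> G 0 = (of_nat (gcd t e) / of_nat t) ^ w)"
      unfolding e_def using eisenstein_dilate_cusp_expansion[OF A assms(1)] by blast
    then obtain G where G: "has_fourier_expansion N (slash w A (?E w t)) (G w t)"
        "G w t 0 = (of_nat (gcd t e) / of_nat t) ^ w" if "t dvd N" "even w" "w \<ge> 4" for w t
      by metis
    have "has_fourier_expansion N (slash (2 * k) A C) 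
       (\<lambda>n. (\<Sum>i\<le>n. G (2 * l) a i * G (2 * m) b (n - i)) - (\<Sum>d\<in>?D. x d * G (2 * k) d n))"
      unfolding slash_C[abs_def]
      by (intro has_fourier_expansion_diff has_fourier_expansion_mult has_fourier_expansion_lincomb G) 
         (use ab w assms(1) in auto)
    moreover have "(\<Sum>i\<le>0. G (2 * l) a i * G (2 * m) b (0 - i)) - (\<Sum>d\<in>?D. x d * G (2 * k) d 0) = 0"
      using ab w system[OF e] by (simp add: G(2))
    ultimately show "\<exists>c. has_fourier_expansion N (slash (2 * k) A C) c \<and> c 0 = 0" by blast
  qed
  moreover have "?E (2 * l) a z * ?E (2 * m) b z = (\<Sum>d\<in>?D. x d * ?E (2 * k) d z) + C z" for z
    by (simp add: C_def)
  moreover have "of_nat (convolution_sum a (2 * l - 1) b (2 * m - 1) n) =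
         - of_nat k * of_real (bernoulli (2 * l)) * of_real (bernoulli (2 * m)) /
           (4 * of_nat l * of_nat m * of_real (bernoulli (2 * k))) *
         (\<Sum>d\<in>?D. x d * of_nat (divisor_sigma (2 * k - 1) (of_nat n / of_nat d)))
         + of_real (bernoulli (2 * l)) / (4 * of_nat l) *
             of_nat (divisor_sigma (2 * m - 1) (of_nat n / of_nat b))
         + of_real (bernoulli (2 * m)) / (4 * of_nat m) *
             of_nat (divisor_sigma (2 * l - 1) (of_nat n / of_nat a))
         + of_real (bernoulli (2 * l)) * of_real (bernoulli (2 * m)) /
             (16 * of_nat l * of_nat m) * fourier_coeff n C" if n: "n > 0" for n
  proof (rule convolution_sum_from_cusp_coefficient)
    let ?f = "\<lambda>i. F (2 * l) a i * F (2 * m) b (n - i)"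
    let ?L = "4 * of_nat l / of_real (bernoulli (2 * l)) :: complex"
    let ?M = "4 * of_nat m / of_real (bernoulli (2 * m)) :: complex"
    let ?\<sigma> = "\<lambda>w t i. of_nat (divisor_sigma (w - 1) (of_nat i / of_nat t)) :: complex"
    show "of_real (bernoulli (2 * l)) \<noteq> (0::complex)" "of_real (bernoulli (2 * m)) \<noteq> (0::complex)"
      using assms by (auto simp: bernoulli_even_nonzero)
    show "of_nat l \<noteq> (0::complex)" "of_nat m \<noteq> (0::complex)" using assms by auto
    \<comment> \<open>the two ends of the Cauchy product carry the constant terms \<open>1\<close> and give the single \<open>\<sigma>\<close>-terms\<close>
    have "{..n} = insert 0 (insert n {0<..<n})" using n by auto
    hence "(\<Sum>i\<le>n. ?f i) = ?f 0 + (?f n + (\<Sum>i\<in>{0<..<n}. ?f i))" using n by simp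
    also have "(\<Sum>i\<in>{0<..<n}. ?f i) = (\<Sum>i\<in>{0<..<n}. ?L * ?M * (?\<sigma> (2 * l) a i * ?\<sigma> (2 * m) b (n - i)))"
      by (intro sum.cong refl) (auto simp: F_def)
    also have "\<dots> = ?L * ?M * of_nat (convolution_sum a (2 * l - 1) b (2 * m - 1) n)"
      unfolding convolution_sum_eq[OF assms(5,6), symmetric] of_nat_sum of_nat_mult sum_distrib_left ..
    also have "?f 0 = - ?M * ?\<sigma> (2 * m) b n" using n by (simp add: F_def)
    also have "?f n = - ?L * ?\<sigma> (2 * l) a n" using n by (simp add: F_def)
    finally have 1: "(\<Sum>i\<le>n. ?f i) = - ?M * ?\<sigma> (2 * m) b n - ?L * ?\<sigma> (2 * l) a n + 
        ?L * ?M * of_nat (convolution_sum a (2 * l - 1) b (2 * m - 1) n)" by simp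
    have 2: "(\<Sum>d\<in>?D. x d * F (2 * k) d n) = 
       - (4 * of_nat k / of_real (bernoulli (2 * k))) * (\<Sum>d\<in>?D. x d * ?\<sigma> (2 * k) d n)"
      unfolding sum_distrib_left using n by (intro sum.cong refl) (simp add: F_def)
    show "fourier_coeff n C = - ?M * ?\<sigma> (2 * m) b n - ?L * ?\<sigma> (2 * l) a n + 
        ?L * ?M * of_nat (convolution_sum a (2 * l - 1) b (2 * m - 1) n) - 
        (- (4 * of_nat k / of_real (bernoulli (2 * k))) * (\<Sum>d\<in>?D. x d * ?\<sigma> (2 * k) d n))"
      unfolding fourier_coeff_eqI[OF CF] 1 2 ..
  qed
  ultimately show ?thesis unfolding x_def by blast
qed

end
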